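(* Let $\tau,\lambda\in(0,1]$, $\beta\ge0$ satisfy $\tau(1+\lambda)>1$ and $\beta+\lambda\le1$, and let $W:\mathbb{R}\times\mathbb{R}^d\to\mathbb{R}^d$ satisfy $\|W\|_{\beta,\tau,\lambda;a,b}<\infty$ for all $a<b$. Let $t_0\in\mathbb{R}$ and let an initial value $\varphi_{t_0}\in\mathbb{R}^d$ be given. Then for any $T>0$ the equation $$\varphi_t=\varphi_{t_0}+\int_{t_0}^tW(ds,\varphi_s)$$ has a solution in the space $C^\tau([t_0-T,t_0+T])$ of $\tau$-Hölder continuous $\mathbb{R}^d$-valued functions. Moreover, if $\varphi$ is a solution in $C^\tau([t_0-T,t_0+T])$, then $$\sup_{t\in[t_0-T,t_0+T]}|\varphi_t|+\sup_{t_0-T\le s<t\le t_0+T}\frac{|\varphi_t-\varphi_s|}{|t-s|^\tau}\le C_{\tau,\lambda,T}\,\exp\left(\kappa_{\tau,\lambda,T}\,\|W\|_{\beta,\tau,\lambda;t_0-T,t_0+T}^{\frac{1-\tau+\tau\lambda}{\tau\lambda}}\right)(1\vee|\varphi_{t_0}|),$$ where the constants $\kappa_{\tau,\lambda,T}$ and $C_{\tau,\lambda,T}$ depend only on $\lambda$, $\tau$ and $T$.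
   Context: For $a<b$, $$\|W\|_{\beta,\tau,\lambda;a,b}=\sup_{\substack{a\le s<t\le b\\ x\ne y}}\frac{|W(s,x)-W(t,x)-W(s,y)+W(t,y)|}{(1+|x|+|y|)^\beta|t-s|^\tau|x-y|^\lambda}+\sup_{\substack{a\le s<t\le b\\ x\in\mathbb{R}^d}}\frac{|W(s,x)-W(t,x)|}{(1+|x|)^{\beta+\lambda}|t-s|^\tau}+\sup_{\substack{a\le t\le b\\ x\ne y}}\frac{|W(t,y)-W(t,x)|}{(1+|x|+|y|)^\beta|x-y|^\lambda}.$$ For $a<b$ the nonlinear Young integral $\int_a^bW(ds,\varphi_s)$ is the limit, as the mesh of the partition $a=t_0'<\dots<t_m'=b$ tends to $0$, of $\sum_{i=0}^{m-1}[W(t'_{i+1},\varphi_{t'_i})-W(t'_i,\varphi_{t'_i})]$; it exists when $\varphi$ is $\gamma$-Hölder with $\tau+\lambda\gamma>1$ (here $\gamma=\tau$). For $t<t_0$, $\int_{t_0}^t=-\int_t^{t_0}$. *)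

theory Defs
  imports "HOL-Analysis.Analysis" "HOL-Library.Function_Algebras"
begin

text \<open>
  The constants in the theorem do not depend on the dimension \<open>d\<close>, so \<open>d\<close> has to be quantified
  inside the formula and cannot be a type. We use the carrier of the library's \<open>Euclidean_space d\<close>:
  the functions \<open>x :: nat \<Rightarrow> real\<close> with \<open>x i = 0\<close> for all \<open>i \<ge> d\<close>, with pointwise operations.
\<close>

type_synonym vec_seq = "nat \<Rightarrow> real"

abbreviation Rd :: "nat \<Rightarrow> vec_seq set" where
  "Rd d \<equiv> topspace (Euclidean_space d)"

definition enorm :: "nat \<Rightarrow> vec_seq \<Rightarrow> real" where
  "enorm d x = L2_set x {..<d}"

text \<open>
  Suprema are taken in \<open>ennreal\<close>, so that finiteness is a genuine condition. All denominators
  below are positive on the index sets over which the suprema are taken.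
\<close>

definition W_norm ::
  "nat \<Rightarrow> real \<Rightarrow> real \<Rightarrow> real \<Rightarrow> real \<Rightarrow> real \<Rightarrow> (real \<Rightarrow> vec_seq \<Rightarrow> vec_seq) \<Rightarrow> ennreal" where
  "W_norm d \<beta> \<tau> lam a b W =
     (SUP (s, t, x, y) \<in> {(s, t, x, y). a \<le> s \<and> s < t \<and> t \<le> b \<and> x \<in> Rd d \<and> y \<in> Rd d \<and> x \<noteq> y}.
        ennreal (enorm d (W s x - W t x - W s y + W t y) /
          ((1 + enorm d x + enorm d y) powr \<beta> * \<bar>t - s\<bar> powr \<tau> * enorm d (x - y) powr lam)))
   + (SUP (s, t, x) \<in> {(s, t, x). a \<le> s \<and> s < t \<and> t \<le> b \<and> x \<in> Rd d}.
        ennreal (enorm d (W s x - W t x) /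
          ((1 + enorm d x) powr (\<beta> + lam) * \<bar>t - s\<bar> powr \<tau>)))
   + (SUP (t, x, y) \<in> {(t, x, y). a \<le> t \<and> t \<le> b \<and> x \<in> Rd d \<and> y \<in> Rd d \<and> x \<noteq> y}.
        ennreal (enorm d (W t y - W t x) /
          ((1 + enorm d x + enorm d y) powr \<beta> * enorm d (x - y) powr lam)))"

text \<open>The points \<open>p 0 < \<dots> < p m\<close> of a partition of \<open>[a, b]\<close>; \<open>m = 0\<close> exactly when \<open>a = b\<close>.\<close>

definition is_partition :: "real \<Rightarrow> real \<Rightarrow> nat \<Rightarrow> (nat \<Rightarrow> real) \<Rightarrow> bool" where
  "is_partition a b m p \<longleftrightarrow> p 0 = a \<and> p m = b \<and> (\<forall>i<m. p i < p (Suc i))"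

definition young_sum ::
  "(real \<Rightarrow> vec_seq \<Rightarrow> vec_seq) \<Rightarrow> (real \<Rightarrow> vec_seq) \<Rightarrow> nat \<Rightarrow> (nat \<Rightarrow> real) \<Rightarrow> vec_seq" where
  "young_sum W \<phi> m p = (\<Sum>i<m. W (p (Suc i)) (\<phi> (p i)) - W (p i) (\<phi> (p i)))"

text \<open>The integral exists and equals \<open>I\<close>; first for \<open>a \<le> b\<close>, then with orientation.\<close>

definition has_young_integral ::
  "nat \<Rightarrow> (real \<Rightarrow> vec_seq \<Rightarrow> vec_seq) \<Rightarrow> (real \<Rightarrow> vec_seq) \<Rightarrow> real \<Rightarrow> real \<Rightarrow> vec_seq \<Rightarrow> bool" where
  "has_young_integral d W \<phi> a b I \<longleftrightarrow> I \<in> Rd d \<and>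
     (\<forall>\<epsilon>>0. \<exists>\<delta>>0. \<forall>m p. is_partition a b m p \<and> (\<forall>i<m. p (Suc i) - p i < \<delta>) \<longrightarrow>
        enorm d (young_sum W \<phi> m p - I) < \<epsilon>)"

definition has_oriented_young_integral ::
  "nat \<Rightarrow> (real \<Rightarrow> vec_seq \<Rightarrow> vec_seq) \<Rightarrow> (real \<Rightarrow> vec_seq) \<Rightarrow> real \<Rightarrow> real \<Rightarrow> vec_seq \<Rightarrow> bool" where
  "has_oriented_young_integral d W \<phi> a b I \<longleftrightarrow>
     (if a \<le> b then has_young_integral d W \<phi> a b I
      else (\<exists>J. has_young_integral d W \<phi> b a J \<and> I = (\<lambda>k. - J k)))"

definition sup_norm :: "nat \<Rightarrow> real \<Rightarrow> real \<Rightarrow> (real \<Rightarrow> vec_seq) \<Rightarrow> ennreal" where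
  "sup_norm d a b \<phi> = (SUP t \<in> {a..b}. ennreal (enorm d (\<phi> t)))"

definition holder_seminorm :: "nat \<Rightarrow> real \<Rightarrow> real \<Rightarrow> real \<Rightarrow> (real \<Rightarrow> vec_seq) \<Rightarrow> ennreal" where
  "holder_seminorm d \<tau> a b \<phi> =
     (SUP (s, t) \<in> {(s, t). a \<le> s \<and> s < t \<and> t \<le> b}.
        ennreal (enorm d (\<phi> t - \<phi> s) / \<bar>t - s\<bar> powr \<tau>))"

text \<open>Only the values on \<open>[a, b]\<close> matter; elsewhere \<open>\<phi>\<close> is arbitrary.\<close>

definition holder_space :: "nat \<Rightarrow> real \<Rightarrow> real \<Rightarrow> real \<Rightarrow> (real \<Rightarrow> vec_seq) set" where
  "holder_space d \<tau> a b = {\<phi>. (\<forall>t\<in>{a..b}. \<phi> t \<in> Rd d) \<and> holder_seminorm d \<tau> a b \<phi> < \<infinity>}"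

definition is_solution ::
  "nat \<Rightarrow> (real \<Rightarrow> vec_seq \<Rightarrow> vec_seq) \<Rightarrow> real \<Rightarrow> real \<Rightarrow> vec_seq \<Rightarrow> (real \<Rightarrow> vec_seq) \<Rightarrow> bool" where
  "is_solution d W t0 T v \<phi> \<longleftrightarrow>
     (\<forall>t\<in>{t0 - T..t0 + T}. \<exists>I. has_oriented_young_integral d W \<phi> t0 t I \<and> \<phi> t = v + I)"

end

theory Submission
  imports Defs
begin

text \<open>
  Let \<open>N\<close> be the norm of \<open>W\<close> and \<open>\<theta> = \<tau> (1 + \<lambda>) > 1\<close>. Davie's discrete sewing argument shows that the increment
  of a path over \<open>[s, t]\<close> differs from \<open>W(t, \<phi>\<^sub>s) - W(s, \<phi>\<^sub>s)\<close> by at most \<open>K N S\<^sup>\<beta> H\<^sup>\<lambda> (t - s)\<^sup>\<theta>\<close>, where \<open>S\<close>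
  bounds \<open>1 + \<bar>\<phi>\<bar>\<close> and \<open>H\<close> is a Hoelder constant there; this applies alike to solutions and to Euler schemes.
  As \<open>\<beta> + \<lambda> \<le> 1\<close>, the bound is at most linear in the size of the path, so over a time step \<open>\<Delta>\<close> with
  \<open>N \<Delta>\<^sup>\<tau>\<close> small \<open>1 + \<bar>\<phi>\<bar>\<close> at most doubles; the number of steps is of order \<open>1 + T N powr (1 / \<tau>)\<close>.
  For existence, a cluster point of the Euler schemes inherits the one-step estimate, and since \<open>\<theta> > 1\<close> this
  alone makes the Riemann sums converge to its increments. Times before \<open>t0\<close> are handled by reversing time.
\<close>

text \<open>A solution is only as regular as \<open>W\<close> is in time, so its \<tau>-Hoelder
  constant \<open>H\<close> need not shrink on short intervals, and smallness must come from
  elsewhere. It comes from \<open>H * \<Delta> powr \<tau>\<close>, which bounds the oscillation: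
  with \<open>S0\<close> the size at a reference point, the one-step estimate yields
  \<open>H \<le> N * (1 + K) * (S0 + H * \<Delta> powr \<tau>)\<close>, and the term with
  \<open>H\<close> is absorbed on the left after multiplication by
  \<open>\<Delta> powr \<tau>\<close>. Absorption presupposes some finite Hoelder constant but is
  indifferent to its size. This is why the one-step estimate is kept for all admissible
  \<open>H\<close> and \<open>S\<close> and for all pairs of times. The constants may depend neither
  on \<open>d\<close> nor on \<beta>: estimates treat the norm as a whole, coordinates enter only
  when limits are taken, and \<beta> is removed by \<open>2 powr \<beta> \<le> 2\<close> and
  \<open>\<beta> + lam \<le> 1\<close>.\<close>

section \<open>The Euclidean norm on \<open>Rd d\<close>\<close>

lemma Rd_iff: "x \<in> Rd d \<longleftrightarrow> (\<forall>i\<ge>d. x i = 0)"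
  by (simp add: topspace_Euclidean_space)

lemma Rd_add: "x \<in> Rd d \<Longrightarrow> y \<in> Rd d \<Longrightarrow> x + y \<in> Rd d"
  by (simp add: Rd_iff)

lemma Rd_diff: "x \<in> Rd d \<Longrightarrow> y \<in> Rd d \<Longrightarrow> x - y \<in> Rd d"
  by (simp add: Rd_iff)

lemma enorm_nonneg [simp]: "0 \<le> enorm d x"
  by (simp add: enorm_def)

lemma enorm_zero [simp]: "enorm d 0 = 0"
  by (simp add: enorm_def L2_set_def)

lemma enorm_minus [simp]: "enorm d (- x) = enorm d x"
  by (simp add: enorm_def L2_set_def)

lemma enorm_minus_commute: "enorm d (x - y) = enorm d (y - x)"
  using enorm_minus [of d "x - y"] by simp

lemma enorm_triangle: "enorm d (x + y) \<le> enorm d x + enorm d y"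
  using L2_set_triangle_ineq [of x y "{..<d}"] by (simp add: enorm_def plus_fun_def)

lemma enorm_triangle_diff: "enorm d (x - y) \<le> enorm d x + enorm d y"
  using enorm_triangle [of d x "- y"] by simp

lemma enorm_triangle_le: "z = x + y \<Longrightarrow> enorm d x \<le> A \<Longrightarrow> enorm d y \<le> B \<Longrightarrow> enorm d z \<le> A + B"
  using enorm_triangle [of d x y] by simp

lemma enorm_le_add_diff: "enorm d x \<le> enorm d y + enorm d (x - y)"
  using enorm_triangle [of d y "x - y"] by simp

lemma enorm_sum_le: "enorm d (sum f A) \<le> (\<Sum>i\<in>A. enorm d (f i))"
proof (induction A rule: infinite_finite_induct)
  case (insert i A)
  have "enorm d (sum f (insert i A)) = enorm d (f i + sum f A)"
    using insert by (subst sum.insert) auto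
  also have "\<dots> \<le> enorm d (f i) + (\<Sum>i\<in>A. enorm d (f i))"
    using enorm_triangle [of d "f i" "sum f A"] insert by linarith
  also have "\<dots> = (\<Sum>i\<in>insert i A. enorm d (f i))"
    using insert by simp
  finally show ?case .
qed (simp_all add: enorm_def L2_set_def)

text \<open>\<open>enorm d\<close> does not see the coordinates from \<open>d\<close> on, so
  definiteness holds only on \<open>Rd d\<close>.\<close>

lemma enorm_eq_0_iff: "x \<in> Rd d \<Longrightarrow> enorm d x = 0 \<longleftrightarrow> x = 0"
  by (auto simp: enorm_def L2_set_eq_0_iff Rd_iff fun_eq_iff not_less [symmetric])

lemma abs_component_le_enorm: "i < d \<Longrightarrow> \<bar>x i\<bar> \<le> enorm d x"
  using member_le_L2_set [of "{..<d}" i "\<lambda>i. \<bar>x i\<bar>"]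
  by (simp add: enorm_def L2_set_def)

lemma tendsto_enorm:
  assumes "\<And>i. i < d \<Longrightarrow> ((\<lambda>n. f n i) \<longlongrightarrow> x i) F"
  shows "((\<lambda>n. enorm d (f n)) \<longlongrightarrow> enorm d x) F"
  unfolding enorm_def L2_set_def
  using assms by (intro tendsto_intros) auto

lemma tendsto_component:
  assumes "((\<lambda>n. enorm d (f n - x)) \<longlongrightarrow> 0) F" and "i < d"
  shows "((\<lambda>n. f n i) \<longlongrightarrow> x i) F"
proof -
  have "((\<lambda>n. f n i - x i) \<longlongrightarrow> 0) F"
  proof (rule Lim_null_comparison [OF _ assms(1)])
    show "\<forall>\<^sub>F n in F. norm (f n i - x i) \<le> enorm d (f n - x)"
      using abs_component_le_enorm [OF assms(2), of "f _ - x"] by simp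
  qed
  then show ?thesis
    by (simp add: LIM_zero_iff)
qed

subsection \<open>Discrete sewing\<close>

text \<open>The solution \<open>C\<close> of \<open>C = 2 * (C * (1 / 2) powr \<theta>) + 2\<close>,
  the recursion of Davie's argument: two pieces of at most half the length plus two defects. For
  \<open>\<theta> > 1\<close> the coefficient \<open>2 powr (1 - \<theta>)\<close> of
  \<open>C\<close> is below 1.\<close>

definition sewing_const :: "real \<Rightarrow> real"
  where "sewing_const \<theta> = 2 / (1 - 2 powr (1 - \<theta>))"

lemma sewing_const_pos: "1 < \<theta> \<Longrightarrow> 0 < sewing_const \<theta>"
  using powr_less_mono [of "1 - \<theta>" 0 2] by (simp add: sewing_const_def)

lemma sewing_const_eq:
  assumes "1 < \<theta>"
  shows "2 * (sewing_const \<theta> * (1 / 2) powr \<theta>) + 2 = sewing_const \<theta>"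
proof -
  have q: "2 powr (1 - \<theta>) < (1::real)"
    using powr_less_mono [of "1 - \<theta>" 0 2] assms by simp
  have "2 * (1 / 2) powr \<theta> = (2::real) powr (1 - \<theta>)"
    by (simp add: powr_diff powr_divide)
  then have "2 * (sewing_const \<theta> * (1 / 2) powr \<theta>) = sewing_const \<theta> * 2 powr (1 - \<theta>)"
    by (metis mult.left_commute)
  also have "\<dots> + 2 = sewing_const \<theta>"
  proof -
    have "2 / (1 - q) * q + 2 = 2 / (1 - q)" if "q < 1" for q :: real
      using that by (simp add: field_simps)
    then show ?thesis
      using q unfolding sewing_const_def by blast
  qed
  finally show ?thesis by simp
qed

text \<open>Davie's argument: cut \<open>{i..j}\<close> around its middle step, on which \<open>R\<close> vanishes, into two
  pieces of at most half the length.\<close>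

lemma discrete_sewing:
  fixes R :: "nat \<Rightarrow> nat \<Rightarrow> vec_seq"
  assumes \<theta>: "1 < \<theta>" and A: "0 \<le> A"
    and diag: "\<And>i. R i i = 0" and step: "\<And>i. R i (Suc i) = 0"
    and defect: "\<And>i j k. i \<le> j \<Longrightarrow> j \<le> k \<Longrightarrow> k \<le> n \<Longrightarrow>
      enorm d (R i k - R i j - R j k) \<le> A * real (k - i) powr \<theta>"
    and "i \<le> j" "j \<le> n"
  shows "enorm d (R i j) \<le> sewing_const \<theta> * A * real (j - i) powr \<theta>"
  using \<open>i \<le> j\<close> \<open>j \<le> n\<close>
proof (induction "j - i" arbitrary: i j rule: less_induct)
  case less
  let ?C = "sewing_const \<theta>"
  have C: "0 \<le> ?C"
    using sewing_const_pos [OF \<theta>] by simp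
  show ?case
  proof (cases "j - i \<le> 1")
    case True
    then have "j = i \<or> j = Suc i"
      using less.prems by auto
    then show ?thesis
      using C A diag step by auto
  next
    case False
    define L where "L = j - i"
    \<comment> \<open>The step from \<open>m\<close> to \<open>Suc m\<close> is removed, so the
      pieces have total length \<open>L - 1\<close> and both can have length at most
      \<open>L div 2\<close>, for even and odd \<open>L\<close> alike.\<close>
    define m where "m = i + (L - 1) div 2"
    have L: "2 \<le> L" "j = i + L"
      using False less.prems by (auto simp: L_def)
    have m: "i \<le> m" "Suc m \<le> j" "m - i < L" "j - Suc m < L"
      "2 * (m - i) \<le> L" "2 * (j - Suc m) \<le> L"
      using L by (auto simp: m_def)
    have half: "real k powr \<theta> \<le> (1 / 2) powr \<theta> * real L powr \<theta>" if "2 * k \<le> L" for k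
    proof -
      have "real k powr \<theta> \<le> (1 / 2 * real L) powr \<theta>"
        using that \<theta> by (intro powr_mono2) auto
      also have "\<dots> = (1 / 2) powr \<theta> * real L powr \<theta>"
        by (rule powr_mult)
      finally show ?thesis .
    qed
    have 1: "enorm d (R i m) \<le> ?C * A * ((1 / 2) powr \<theta> * real L powr \<theta>)"
      by (rule order_trans [OF less.hyps mult_left_mono [OF half]])
        (use m less.prems C A L_def in auto)
    have 2: "enorm d (R (Suc m) j) \<le> ?C * A * ((1 / 2) powr \<theta> * real L powr \<theta>)"
      by (rule order_trans [OF less.hyps mult_left_mono [OF half]])
        (use m less.prems C A L_def in auto)
    have 3: "enorm d (R i j - R i m - R m j) \<le> A * real L powr \<theta>"
      using defect [of i m j] m less.prems by (simp add: L_def)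
    have "enorm d (R m j - R m (Suc m) - R (Suc m) j) \<le> A * real (j - m) powr \<theta>"
      using defect [of m "Suc m" j] m less.prems by simp
    also have "\<dots> \<le> A * real L powr \<theta>"
      using A m \<theta> by (intro mult_left_mono powr_mono2) (auto simp: L_def)
    finally have 4: "enorm d (R m j - R m (Suc m) - R (Suc m) j) \<le> A * real L powr \<theta>" .
    \<comment> \<open>Two defects, from cutting at \<open>m\<close> and then at
      \<open>Suc m\<close>; the term \<open>R m (Suc m)\<close> vanishes.\<close>
    have "R i j = ((R i j - R i m - R m j) + (R m j - R m (Suc m) - R (Suc m) j)) + (R i m + R (Suc m) j)"
      using step by simp
    then have "enorm d (R i j) \<le> (A * real L powr \<theta> + A * real L powr \<theta>) +
        (?C * A * ((1 / 2) powr \<theta> * real L powr \<theta>) + ?C * A * ((1 / 2) powr \<theta> * real L powr \<theta>))"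
      by (rule enorm_triangle_le) (use 1 2 3 4 in \<open>blast intro: enorm_triangle_le\<close>)+
    also have "\<dots> = (2 * (?C * (1 / 2) powr \<theta>) + 2) * (A * real L powr \<theta>)"
      by (simp add: algebra_simps)
    also have "\<dots> = ?C * A * real L powr \<theta>"
      by (simp only: sewing_const_eq [OF \<theta>] mult.assoc)
    finally show ?thesis
      by (simp add: L_def)
  qed
qed

text \<open>\<open>N\<close> is any bound for the three seminorms on the window from
  \<open>a\<close> to \<open>b\<close>. The bounds are required for unordered \<open>s\<close> and
  \<open>t\<close> and include the diagonal, so that subintervals and the time reversal of
  \<open>W\<close> are again instances.\<close>

locale young_field =
  fixes d :: nat and \<beta> \<tau> lam N a b :: real and W :: "real \<Rightarrow> vec_seq \<Rightarrow> vec_seq"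
  assumes tau_pos: "0 < \<tau>" and tau_le: "\<tau> \<le> 1"
    and lam_pos: "0 < lam" and lam_le: "lam \<le> 1"
    and young: "1 < \<tau> * (1 + lam)"
    and beta_nonneg: "0 \<le> \<beta>" and beta_lam: "\<beta> + lam \<le> 1"
    and N_nonneg: "0 \<le> N"
    and maps: "x \<in> Rd d \<Longrightarrow> W t x \<in> Rd d"
    and mixed: "\<lbrakk>s \<in> {a..b}; t \<in> {a..b}; x \<in> Rd d; y \<in> Rd d\<rbrakk> \<Longrightarrow>
      enorm d ((W t x - W s x) - (W t y - W s y))
        \<le> N * (1 + enorm d x + enorm d y) powr \<beta> * \<bar>t - s\<bar> powr \<tau> * enorm d (x - y) powr lam"
    and time: "\<lbrakk>s \<in> {a..b}; t \<in> {a..b}; x \<in> Rd d\<rbrakk> \<Longrightarrow>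
      enorm d (W t x - W s x) \<le> N * (1 + enorm d x) powr (\<beta> + lam) * \<bar>t - s\<bar> powr \<tau>"
    and space: "\<lbrakk>t \<in> {a..b}; x \<in> Rd d; y \<in> Rd d\<rbrakk> \<Longrightarrow>
      enorm d (W t x - W t y) \<le> N * (1 + enorm d x + enorm d y) powr \<beta> * enorm d (x - y) powr lam"
begin

abbreviation "\<theta> \<equiv> \<tau> * (1 + lam)"

text \<open>The factor 2 is that of \<open>mixed_bound\<close>; \<open>K\<close> depends on \<tau>
  and \<open>lam\<close> only.\<close>

definition "K = 2 * sewing_const \<theta>"

lemma K_pos: "0 < K"
  using sewing_const_pos [OF young] by (simp add: K_def)

text \<open>The time increment contributes \<open>r powr \<tau>\<close> and the Hoelder increment in
  space \<open>r powr (\<tau> * lam)\<close>, which together give the exponent \<theta>. The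
  constant 2 bounds \<open>2 powr \<beta>\<close>, uniformly in \<beta>.\<close>

lemma mixed_bound:
  assumes "s \<in> {a..b}" "t \<in> {a..b}" "x \<in> Rd d" "y \<in> Rd d"
    and "1 + enorm d x \<le> S" "1 + enorm d y \<le> S"
    and "0 \<le> H" "0 \<le> r" "enorm d (x - y) \<le> H * r powr \<tau>" "\<bar>t - s\<bar> \<le> r"
  shows "enorm d ((W t x - W s x) - (W t y - W s y)) \<le> 2 * N * S powr \<beta> * H powr lam * r powr \<theta>"
proof -
  have S: "1 \<le> S"
    using assms(5) enorm_nonneg [of d x] by linarith
  have "2 powr \<beta> \<le> (2::real)"
    using powr_mono [of \<beta> 1 2] beta_lam lam_pos by simp
  have "(1 + enorm d x + enorm d y) powr \<beta> \<le> (2 * S) powr \<beta>"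
    using assms beta_nonneg enorm_nonneg [of d x] enorm_nonneg [of d y]
    by (intro powr_mono2) linarith+
  also have "\<dots> \<le> 2 * S powr \<beta>"
    using \<open>2 powr \<beta> \<le> 2\<close> S by (simp add: powr_mult mult_right_mono)
  finally have 1: "(1 + enorm d x + enorm d y) powr \<beta> \<le> 2 * S powr \<beta>" .
  have 2: "\<bar>t - s\<bar> powr \<tau> \<le> r powr \<tau>"
    using assms tau_pos by (intro powr_mono2) auto
  have "enorm d (x - y) powr lam \<le> (H * r powr \<tau>) powr lam"
    using assms lam_pos by (intro powr_mono2) auto
  also have "\<dots> = H powr lam * r powr (\<tau> * lam)"
    using assms by (simp add: powr_mult powr_powr)
  finally have 3: "enorm d (x - y) powr lam \<le> H powr lam * r powr (\<tau> * lam)" .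
  have "enorm d ((W t x - W s x) - (W t y - W s y))
      \<le> N * (1 + enorm d x + enorm d y) powr \<beta> * \<bar>t - s\<bar> powr \<tau> * enorm d (x - y) powr lam"
    using assms mixed by blast
  also have "\<dots> \<le> N * (2 * S powr \<beta>) * r powr \<tau> * (H powr lam * r powr (\<tau> * lam))"
    using 1 2 3 N_nonneg S by (intro mult_mono) auto
  also have "\<dots> = 2 * N * S powr \<beta> * H powr lam * r powr \<theta>"
    by (simp add: powr_add distrib_left mult_ac)
  finally show ?thesis .
qed

text \<open>On a uniform grid \<open>p k - p i\<close> is proportional to \<open>k - i\<close>, so
  sewing may count steps. Nothing is assumed about how \<open>\<psi>\<close> arises: it may sample a
  solution or be an Euler scheme.\<close>

lemma grid_estimate:
  fixes \<psi> :: "nat \<Rightarrow> vec_seq"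
  assumes \<delta>: "0 < \<delta>" and p: "p = (\<lambda>i. c + real i * \<delta>)" and range: "a \<le> c" "p n \<le> b"
    and \<psi>: "\<And>i. i \<le> n \<Longrightarrow> \<psi> i \<in> Rd d"
    and S: "\<And>i. i \<le> n \<Longrightarrow> 1 + enorm d (\<psi> i) \<le> S"
    and H: "0 \<le> H" "\<And>i j. i < j \<Longrightarrow> j \<le> n \<Longrightarrow> enorm d (\<psi> j - \<psi> i) \<le> H * (p j - p i) powr \<tau>"
  shows "enorm d ((\<Sum>i<n. W (p (Suc i)) (\<psi> i) - W (p i) (\<psi> i)) - (W (p n) (\<psi> 0) - W (p 0) (\<psi> 0)))
    \<le> K * N * S powr \<beta> * H powr lam * (p n - p 0) powr \<theta>"
proof -
  \<comment> \<open>The sum minus its one-term approximation. The sums are additive and cancel in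
    the defect, which leaves a mixed increment of \<open>W\<close>.\<close>
  define R where "R i j = (\<Sum>k\<in>{i..<j}. W (p (Suc k)) (\<psi> k) - W (p k) (\<psi> k)) - (W (p j) (\<psi> i) - W (p i) (\<psi> i))"
    for i j
  \<comment> \<open>The factor \<open>\<delta> powr \<theta>\<close> converts the step count of
    \<open>discrete_sewing\<close> back into elapsed time.\<close>
  define A where "A = 2 * N * S powr \<beta> * H powr lam * \<delta> powr \<theta>"
  have A: "0 \<le> A"
    using N_nonneg by (simp add: A_def)
  have pin: "p i \<in> {a..b}" if "i \<le> n" for i
  proof -
    have "real i * \<delta> \<le> real n * \<delta>" "0 \<le> real i * \<delta>"
      using that \<delta> by (auto intro: mult_right_mono)
    then show ?thesis
      using range by (simp add: p)
  qed
  have pdiff: "p k - p i = real (k - i) * \<delta>" if "i \<le> k" for i k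
    using that by (simp add: p of_nat_diff algebra_simps)
  have "enorm d (R 0 n) \<le> sewing_const \<theta> * A * real (n - 0) powr \<theta>"
  proof (rule discrete_sewing [where n = n])
    fix i j k :: nat
    assume ijk: "i \<le> j" "j \<le> k" "k \<le> n"
    have "{i..<k} = {i..<j} \<union> {j..<k}"
      using ijk by auto
    then have "(\<Sum>l\<in>{i..<k}. W (p (Suc l)) (\<psi> l) - W (p l) (\<psi> l)) =
      (\<Sum>l\<in>{i..<j}. W (p (Suc l)) (\<psi> l) - W (p l) (\<psi> l)) +
      (\<Sum>l\<in>{j..<k}. W (p (Suc l)) (\<psi> l) - W (p l) (\<psi> l))"
      by (simp only:) (rule sum.union_disjoint, auto)
    then have eq: "R i k - R i j - R j k = (W (p k) (\<psi> j) - W (p j) (\<psi> j)) - (W (p k) (\<psi> i) - W (p j) (\<psi> i))"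
      by (simp add: R_def algebra_simps)
    have "enorm d (\<psi> j - \<psi> i) \<le> H * (p k - p i) powr \<tau>"
    proof (cases "i = j")
      case False
      then have "enorm d (\<psi> j - \<psi> i) \<le> H * (p j - p i) powr \<tau>"
        using ijk H by auto
      also have "\<dots> \<le> H * (p k - p i) powr \<tau>"
        using H ijk \<delta> tau_pos
        by (intro mult_left_mono powr_mono2) (auto simp: p)
      finally show ?thesis .
    qed (use H in auto)
    then have "enorm d (R i k - R i j - R j k) \<le> 2 * N * S powr \<beta> * H powr lam * (p k - p i) powr \<theta>"
      unfolding eq using ijk \<psi> S H pin \<delta>
      by (intro mixed_bound) (auto simp: p)
    also have "\<dots> = A * real (k - i) powr \<theta>"
      using ijk \<delta> by (subst pdiff) (auto simp: A_def powr_mult)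
    finally show "enorm d (R i k - R i j - R j k) \<le> A * real (k - i) powr \<theta>" .
  qed (auto simp: R_def young A)
  also have "\<dots> = K * N * S powr \<beta> * H powr lam * (p n - p 0) powr \<theta>"
    using \<delta> by (subst pdiff) (auto simp: A_def K_def powr_mult)
  finally show ?thesis
    by (simp add: R_def lessThan_atLeast0)
qed

subsection \<open>A priori bounds\<close>

text \<open>The condition \<open>0 \<le> H\<close> bounds the set of admissible constants from below
  even when \<open>X\<close> has at most one point, so its infimum makes sense.\<close>

definition holder_on :: "real set \<Rightarrow> real \<Rightarrow> (real \<Rightarrow> vec_seq) \<Rightarrow> bool" where
  "holder_on X H \<phi> \<longleftrightarrow> 0 \<le> H \<and> (\<forall>x\<in>X. \<forall>y\<in>X. x < y \<longrightarrow> enorm d (\<phi> y - \<phi> x) \<le> H * (y - x) powr \<tau>)"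

text \<open>The one-step estimate shared by solutions (with \<open>G\<close> an interval) and by Euler schemes
  (with \<open>G\<close> a grid); all a priori bounds follow from it alone.\<close>

definition davie_on :: "real set \<Rightarrow> (real \<Rightarrow> vec_seq) \<Rightarrow> bool" where
  "davie_on G \<phi> \<longleftrightarrow> (\<forall>s\<in>G. \<forall>t\<in>G. s < t \<longrightarrow>
     (\<forall>H S. holder_on (G \<inter> {s..t}) H \<phi> \<longrightarrow> (\<forall>x\<in>G \<inter> {s..t}. 1 + enorm d (\<phi> x) \<le> S) \<longrightarrow>
        enorm d (\<phi> t - \<phi> s - (W t (\<phi> s) - W s (\<phi> s)))
          \<le> K * N * S powr \<beta> * H powr lam * (t - s) powr \<theta>))"

text \<open>Cutting by an interval leaves all points of \<open>G\<close> between \<open>s\<close>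
  and \<open>t\<close> in place. Thinning \<open>G\<close> would instead weaken the premises under
  which the estimate has to hold.\<close>

lemma davie_on_Int: "davie_on G \<phi> \<Longrightarrow> davie_on (G \<inter> {u..w}) \<phi>"
proof -
  have "G \<inter> {u..w} \<inter> {s..t} = G \<inter> {s..t}" if "s \<in> {u..w}" "t \<in> {u..w}" for s t
    using that by auto
  then show "davie_on G \<phi> \<Longrightarrow> davie_on (G \<inter> {u..w}) \<phi>"
    by (simp add: davie_on_def)
qed

lemma holder_on_subset: "holder_on X H \<phi> \<Longrightarrow> Y \<subseteq> X \<Longrightarrow> holder_on Y H \<phi>"
  by (auto simp: holder_on_def)

lemma holder_on_abs:
  assumes "holder_on X H \<phi>" "x \<in> X" "y \<in> X"
  shows "enorm d (\<phi> y - \<phi> x) \<le> H * \<bar>y - x\<bar> powr \<tau>"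
proof (cases x y rule: linorder_cases)
  case less
  then show ?thesis using assms by (simp add: holder_on_def)
next
  case greater
  then have "enorm d (\<phi> x - \<phi> y) \<le> H * \<bar>y - x\<bar> powr \<tau>"
    using assms by (simp add: holder_on_def)
  then show ?thesis by (simp add: enorm_minus_commute)
qed simp

text \<open>The estimate is applied with the best Hoelder constant on \<open>X\<close> and half of
  it is absorbed. \<open>H0\<close> serves only to make that constant finite and leaves no trace in
  the conclusion, so the bound is uniform over all Euler schemes.\<close>

lemma local_bound:
  assumes X: "X \<subseteq> {a..b}" and diam: "\<And>s t. s \<in> X \<Longrightarrow> t \<in> X \<Longrightarrow> \<bar>t - s\<bar> \<le> \<Delta>"
    and \<phi>: "\<And>t. t \<in> X \<Longrightarrow> \<phi> t \<in> Rd d"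
    and davie: "davie_on X \<phi>" and H0: "holder_on X H0 \<phi>"
    and \<Delta>: "0 < \<Delta>" "N * \<Delta> powr \<tau> * (1 + K) \<le> 1 / 2"
    and r: "r \<in> X"
  shows "holder_on X ((1 + enorm d (\<phi> r)) / \<Delta> powr \<tau>) \<phi>"
proof -
  define S0 where "S0 = 1 + enorm d (\<phi> r)"
  have S0: "1 \<le> S0"
    by (simp add: S0_def)
  have improve: "holder_on X (N * (1 + K) * (S0 + H * \<Delta> powr \<tau>)) \<phi>" if H: "holder_on X H \<phi>" for H
  proof -
    define S where "S = S0 + H * \<Delta> powr \<tau>"
    have H0: "0 \<le> H"
      using H by (simp add: holder_on_def)
    then have S1: "1 \<le> S"
      using S0 by (simp add: S_def add_increasing2)
    have dist: "H * \<bar>y - x\<bar> powr \<tau> \<le> H * \<Delta> powr \<tau>" if "x \<in> X" "y \<in> X" for x y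
      using diam that H0 tau_pos by (intro mult_left_mono powr_mono2) auto
    have S: "1 + enorm d (\<phi> x) \<le> S" if "x \<in> X" for x
      using enorm_le_add_diff [of d "\<phi> x" "\<phi> r"] holder_on_abs [OF H r that] dist [OF r that]
      by (simp add: S_def S0_def)
    have SS: "S powr (\<beta> + lam) \<le> S"
      using powr_mono [OF beta_lam S1] S1 by simp
    have "enorm d (\<phi> t - \<phi> s) \<le> N * (1 + K) * S * (t - s) powr \<tau>"
      if st: "s \<in> X" "t \<in> X" "s < t" for s t
    proof -
      have "enorm d (W t (\<phi> s) - W s (\<phi> s)) \<le> N * (1 + enorm d (\<phi> s)) powr (\<beta> + lam) * \<bar>t - s\<bar> powr \<tau>"
        using st X \<phi> by (intro time) auto
      also have "\<dots> \<le> N * S powr (\<beta> + lam) * \<bar>t - s\<bar> powr \<tau>"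
        using S [OF st(1)] N_nonneg beta_nonneg lam_pos
        by (intro mult_right_mono mult_left_mono powr_mono2) auto
      also have "\<dots> \<le> N * S * (t - s) powr \<tau>"
        using SS N_nonneg st by (simp add: mult_left_mono mult_right_mono)
      finally have 1: "enorm d (W t (\<phi> s) - W s (\<phi> s)) \<le> N * S * (t - s) powr \<tau>" .
      \<comment> \<open>Only the factor \<open>(t - s) powr \<tau>\<close> is kept as time
        regularity; the rest combines with \<open>H\<close> into an oscillation, which is at most
        \<open>S\<close>. Then \<open>\<beta> + lam \<le> 1\<close> makes everything linear in
        \<open>S\<close>.\<close>
      have "H powr lam * (t - s) powr \<theta> = (H * (t - s) powr \<tau>) powr lam * (t - s) powr \<tau>"
        using st H0 by (simp add: powr_mult powr_powr powr_add [symmetric] distrib_left add.commute)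
      also have "\<dots> \<le> S powr lam * (t - s) powr \<tau>"
        using dist [OF st(1,2)] st H0 lam_pos S0
        by (intro mult_right_mono powr_mono2) (auto simp: S_def)
      finally have 2: "H powr lam * (t - s) powr \<theta> \<le> S powr lam * (t - s) powr \<tau>" .
      have "holder_on (X \<inter> {s..t}) H \<phi>" "\<forall>x\<in>X \<inter> {s..t}. 1 + enorm d (\<phi> x) \<le> S"
        using H S by (auto intro: holder_on_subset)
      then have "enorm d (\<phi> t - \<phi> s - (W t (\<phi> s) - W s (\<phi> s)))
          \<le> K * N * S powr \<beta> * H powr lam * (t - s) powr \<theta>"
        using davie st unfolding davie_on_def by blast
      also have "\<dots> \<le> K * N * S powr \<beta> * (S powr lam * (t - s) powr \<tau>)"
        using 2 K_pos N_nonneg by (simp add: mult.assoc mult_left_mono)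
      also have "\<dots> = K * N * S powr (\<beta> + lam) * (t - s) powr \<tau>"
        by (simp add: powr_add)
      also have "\<dots> \<le> K * N * S * (t - s) powr \<tau>"
        using SS N_nonneg K_pos by (simp add: mult_left_mono mult_right_mono)
      finally have 3: "enorm d (\<phi> t - \<phi> s - (W t (\<phi> s) - W s (\<phi> s))) \<le> K * N * S * (t - s) powr \<tau>" .
      show ?thesis
        using enorm_le_add_diff [of d "\<phi> t - \<phi> s" "W t (\<phi> s) - W s (\<phi> s)"] 1 3
        by (simp add: algebra_simps)
    qed
    then show ?thesis
      using N_nonneg K_pos S1 by (simp add: holder_on_def S_def)
  qed
  define V where "V = {H. holder_on X H \<phi>}"
  \<comment> \<open>The infimum is itself admissible, so \<open>improve\<close> applies to it and
    bounds it in terms of itself.\<close>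
  define H where "H = Inf V"
  have V: "V \<noteq> {}" "bdd_below V"
    using H0 by (auto simp: V_def holder_on_def intro: bdd_belowI [of _ 0])
  have H: "holder_on X H \<phi>"
    unfolding holder_on_def
  proof (intro conjI ballI impI)
    show "0 \<le> H"
      unfolding H_def using V by (intro cInf_greatest) (auto simp: V_def holder_on_def)
    fix x y assume xy: "x \<in> X" "y \<in> X" "x < y"
    have "enorm d (\<phi> y - \<phi> x) / (y - x) powr \<tau> \<le> H"
      unfolding H_def using V xy
      by (intro cInf_greatest) (auto simp: V_def holder_on_def divide_le_eq)
    then show "enorm d (\<phi> y - \<phi> x) \<le> H * (y - x) powr \<tau>"
      using xy by (simp add: divide_le_eq)
  qed
  then have "H \<le> N * (1 + K) * (S0 + H * \<Delta> powr \<tau>)"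
    using V improve by (auto simp: H_def V_def intro: cInf_lower)
  then have "H * \<Delta> powr \<tau> \<le> N * (1 + K) * (S0 + H * \<Delta> powr \<tau>) * \<Delta> powr \<tau>"
    by (intro mult_right_mono) auto
  also have "\<dots> = N * \<Delta> powr \<tau> * (1 + K) * (S0 + H * \<Delta> powr \<tau>)"
    by simp
  also have "\<dots> \<le> 1 / 2 * (S0 + H * \<Delta> powr \<tau>)"
    using \<Delta> H S0 by (intro mult_right_mono) (auto simp: holder_on_def)
  finally have "H * \<Delta> powr \<tau> \<le> S0"
    by simp
  then have HS: "H \<le> S0 / \<Delta> powr \<tau>"
    using \<Delta> by (simp add: le_divide_eq)
  have "enorm d (\<phi> y - \<phi> x) \<le> S0 / \<Delta> powr \<tau> * (y - x) powr \<tau>" if "x \<in> X" "y \<in> X" "x < y" for x y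
  proof -
    have "enorm d (\<phi> y - \<phi> x) \<le> H * (y - x) powr \<tau>"
      using H that by (simp add: holder_on_def)
    also have "\<dots> \<le> S0 / \<Delta> powr \<tau> * (y - x) powr \<tau>"
      using HS by (intro mult_right_mono) auto
    finally show ?thesis .
  qed
  then show ?thesis
    using S0 by (simp add: holder_on_def S0_def)
qed

text \<open>Along a chain of \<open>M\<close> steps of length at most \<Delta> the size doubles at
  most \<open>M\<close> times. The chain stays in \<open>G\<close> and may run in either time
  direction, which suits grids and intervals on both sides of \<open>r\<close>. For times further
  apart than \<Delta> the triangle inequality replaces the local bound; it causes the factor
  2.\<close>

lemma global_bound:
  assumes G: "G \<subseteq> {a..b}" and \<phi>: "\<And>t. t \<in> G \<Longrightarrow> \<phi> t \<in> Rd d"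
    and davie: "davie_on G \<phi>" and H0: "holder_on G H0 \<phi>"
    and \<Delta>: "0 < \<Delta>" "N * \<Delta> powr \<tau> * (1 + K) \<le> 1 / 2"
    and chain: "\<And>t. t \<in> G \<Longrightarrow> \<exists>x. x 0 = r \<and> x M = t \<and> (\<forall>k\<le>M. x k \<in> G) \<and> (\<forall>k<M. \<bar>x (Suc k) - x k\<bar> \<le> \<Delta>)"
  defines "S \<equiv> 2 ^ M * (1 + enorm d (\<phi> r))"
  shows "\<forall>t\<in>G. 1 + enorm d (\<phi> t) \<le> S"
    and "holder_on G (2 * S / \<Delta> powr \<tau>) \<phi>"
proof -
  have short: "enorm d (\<phi> t - \<phi> s) \<le> (1 + enorm d (\<phi> s)) / \<Delta> powr \<tau> * \<bar>t - s\<bar> powr \<tau>"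
    if st: "s \<in> G" "t \<in> G" "\<bar>t - s\<bar> \<le> \<Delta>" for s t
  proof -
    \<comment> \<open>The reference point is \<open>s\<close> whether it is the left or the right
      end, so doubling works backwards in time as well.\<close>
    let ?X = "G \<inter> {min s t..max s t}"
    have "holder_on ?X H0 \<phi>"
      using H0 by (rule holder_on_subset) auto
    then have "holder_on ?X ((1 + enorm d (\<phi> s)) / \<Delta> powr \<tau>) \<phi>"
      using st G by (intro local_bound [OF _ _ _ davie_on_Int [OF davie]] \<phi> \<Delta>) auto
    then show ?thesis
      using st by (intro holder_on_abs [of ?X]) auto
  qed
  have double: "1 + enorm d (\<phi> t) \<le> 2 * (1 + enorm d (\<phi> s))"
    if st: "s \<in> G" "t \<in> G" "\<bar>t - s\<bar> \<le> \<Delta>" for s t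
  proof -
    have "\<bar>t - s\<bar> powr \<tau> \<le> \<Delta> powr \<tau>"
      using st tau_pos by (intro powr_mono2) auto
    then have "(1 + enorm d (\<phi> s)) / \<Delta> powr \<tau> * \<bar>t - s\<bar> powr \<tau> \<le> (1 + enorm d (\<phi> s)) / \<Delta> powr \<tau> * \<Delta> powr \<tau>"
      by (intro mult_left_mono) (auto intro: add_nonneg_nonneg)
    then show ?thesis
      using short [OF st] enorm_le_add_diff [of d "\<phi> t" "\<phi> s"] \<Delta> by simp
  qed
  show bound: "\<forall>t\<in>G. 1 + enorm d (\<phi> t) \<le> S"
  proof
    fix t assume "t \<in> G"
    then obtain x where x: "x 0 = r" "x M = t" "\<forall>k\<le>M. x k \<in> G" "\<forall>k<M. \<bar>x (Suc k) - x k\<bar> \<le> \<Delta>"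
      using chain by blast
    have "1 + enorm d (\<phi> (x k)) \<le> 2 ^ k * (1 + enorm d (\<phi> r))" if "k \<le> M" for k
      using that
    proof (induction k)
      case (Suc k)
      then show ?case
        using double [of "x k" "x (Suc k)"] x by fastforce
    qed (simp add: x)
    then show "1 + enorm d (\<phi> t) \<le> S"
      using x by (auto simp: S_def)
  qed
  have S: "0 \<le> S"
    by (simp add: S_def)
  show "holder_on G (2 * S / \<Delta> powr \<tau>) \<phi>"
    unfolding holder_on_def
  proof (intro conjI ballI impI)
    show "0 \<le> 2 * S / \<Delta> powr \<tau>"
      using S by simp
    fix s t assume st: "s \<in> G" "t \<in> G" "s < t"
    have "enorm d (\<phi> t - \<phi> s) \<le> 2 * S * ((t - s) powr \<tau> / \<Delta> powr \<tau>)"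
    proof (cases "t - s \<le> \<Delta>")
      case True
      then have "enorm d (\<phi> t - \<phi> s) \<le> (1 + enorm d (\<phi> s)) * ((t - s) powr \<tau> / \<Delta> powr \<tau>)"
        using short [of s t] st by simp
      also have "\<dots> \<le> 2 * S * ((t - s) powr \<tau> / \<Delta> powr \<tau>)"
        using bound st S by (intro mult_right_mono) force+
      finally show ?thesis .
    next
      case False
      then have "1 \<le> (t - s) powr \<tau> / \<Delta> powr \<tau>"
        using \<Delta> tau_pos by (simp add: le_divide_eq powr_mono2)
      then have "2 * S * 1 \<le> 2 * S * ((t - s) powr \<tau> / \<Delta> powr \<tau>)"
        using S by (intro mult_left_mono) auto
      moreover have "enorm d (\<phi> t - \<phi> s) \<le> 2 * S"
        using bspec [OF bound st(1)] bspec [OF bound st(2)] enorm_triangle_diff [of d "\<phi> t" "\<phi> s"]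
        by linarith
      ultimately show ?thesis
        by linarith
    qed
    then show "enorm d (\<phi> t - \<phi> s) \<le> 2 * S / \<Delta> powr \<tau> * (t - s) powr \<tau>"
      by simp
  qed
qed

lemma step_exists:
  assumes "0 < L"
  obtains M :: nat where "0 < M" "N * (L / M) powr \<tau> * (1 + K) \<le> 1 / 2"
    "real M \<le> 2 + L * (2 * (1 + K)) powr (1 / \<tau>) * N powr (1 / \<tau>)"
proof -
  define c where "c = 2 * (1 + K)"
  define y where "y = L * (c * N) powr (1 / \<tau>)"
  \<comment> \<open>For \<open>N > 0\<close>, \<open>y\<close> is the real number of steps at which
    the smallness condition becomes an equality. The extra 1 keeps \<open>M\<close> positive when
    \<open>N = 0\<close>; together with rounding it costs the 2 in the bound.\<close>
  define M where "M = Suc (nat \<lceil>y\<rceil>)"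
  have c: "0 < c"
    using K_pos by (simp add: c_def)
  have y: "0 \<le> y" "y < real M" "real M \<le> 2 + y"
    using assms unfolding M_def y_def by (auto; linarith)+
  have "c * N * L powr \<tau> = y powr \<tau>"
    using assms c N_nonneg tau_pos by (simp add: y_def powr_mult powr_powr)
  also have "\<dots> \<le> real M powr \<tau>"
    using y tau_pos by (intro powr_mono2) auto
  finally have "N * (L / M) powr \<tau> * (1 + K) \<le> 1 / 2"
    using assms y by (simp add: powr_divide divide_le_eq c_def algebra_simps)
  moreover have "y = L * c powr (1 / \<tau>) * N powr (1 / \<tau>)"
    using c N_nonneg by (simp add: y_def powr_mult)
  ultimately show thesis
    using that [of M] y by (simp add: M_def c_def)
qed

end

subsection \<open>Partitions and Young integrals\<close>

lemma is_partition_mono: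
  assumes p: "is_partition s t m p" and "i \<le> j" "j \<le> m"
  shows "p i \<le> p j"
  using \<open>i \<le> j\<close> \<open>j \<le> m\<close>
proof (induction j rule: dec_induct)
  case (step j)
  then have "p i \<le> p j" "p j < p (Suc j)"
    using p by (simp_all add: is_partition_def Suc_le_eq)
  then show ?case
    by simp
qed simp

lemma is_partition_range: "is_partition s t m p \<Longrightarrow> i \<le> m \<Longrightarrow> p i \<in> {s..t}"
  using is_partition_mono [of s t m p 0 i] is_partition_mono [of s t m p i m]
  by (auto simp: is_partition_def)

lemma is_partition_uniform:
  assumes "s < t" "0 < n"
  shows "is_partition s t n (\<lambda>i. s + real i * ((t - s) / n))"
proof -
  have "0 < (t - s) / n" "real n * ((t - s) / n) = t - s"
    using assms by simp_all
  then show ?thesis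
    unfolding is_partition_def by (metis add.right_neutral add_diff_cancel_left' add_less_cancel_left
        diff_add_cancel add.commute lessI mult_strict_right_mono mult_zero_left of_nat_0 of_nat_less_iff)
qed

lemma fine_partition:
  fixes s t \<delta> :: real
  assumes "s \<le> t" "0 < \<delta>"
  obtains m p where "is_partition s t m p" "\<forall>i<m. p (Suc i) - p i < \<delta>"
proof (cases "s = t")
  case True
  then have "is_partition s t 0 (\<lambda>_. s)"
    by (simp add: is_partition_def)
  then show ?thesis
    using that by blast
next
  case False
  obtain n :: nat where n: "(t - s) / \<delta> < real n"
    using reals_Archimedean2 by blast
  then have "0 < real n"
    using assms by (meson divide_nonneg_pos diff_ge_0_iff_ge le_less_trans)
  moreover have "(t - s) / real n < \<delta>"
    using n assms \<open>0 < real n\<close> by (simp add: divide_less_eq mult.commute)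
  moreover have "s + real (Suc i) * h - (s + real i * h) = h" for i h
    by (simp add: distrib_right)
  ultimately show ?thesis
    using assms False by (intro that [OF is_partition_uniform [of s t n]]) (simp_all only: of_nat_0_less_iff, simp)
qed

lemma concat_partition:
  assumes p: "is_partition s t m p" and q: "is_partition t u n q"
    and "\<forall>i<m. p (Suc i) - p i < \<delta>" "\<forall>i<n. q (Suc i) - q i < \<delta>"
  obtains r where "is_partition s u (m + n) r" "\<forall>i<m+n. r (Suc i) - r i < \<delta>"
    "young_sum W \<phi> (m + n) r = young_sum W \<phi> m p + young_sum W \<phi> n q"
proof -
  define r where "r i = (if i \<le> m then p i else q (i - m))" for i
  have rm: "r (m + i) = q i" for i
  proof (cases "i = 0")
    case True
    have "p m = q 0"
      using p q by (simp add: is_partition_def)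
    then show ?thesis
      by (simp add: True r_def)
  qed (simp add: r_def)
  have step: "r i < r (Suc i) \<and> r (Suc i) - r i < \<delta>" if "i < m + n" for i
  proof (cases "i < m")
    case True
    then show ?thesis
      using p assms(3) by (simp add: r_def is_partition_def)
  next
    case False
    define k where "k = i - m"
    have "i = m + k" "k < n"
      using that False by (simp_all add: k_def)
    then have "r i = q k" "r (Suc i) = q (Suc k)"
      using rm [of k] rm [of "Suc k"] by simp_all
    then show ?thesis
      using q assms(4) \<open>k < n\<close> by (simp add: is_partition_def)
  qed
  have "young_sum W \<phi> (m + k) r = young_sum W \<phi> m p + young_sum W \<phi> k q" for k
  proof (induction k)
    case 0
    have "young_sum W \<phi> m r = young_sum W \<phi> m p"
      unfolding young_sum_def by (rule sum.cong) (auto simp: r_def)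
    then show ?case
      by (simp add: young_sum_def fun_eq_iff)
  next
    case (Suc k)
    then show ?case
      using rm [of k] rm [of "Suc k"] by (simp add: young_sum_def add.assoc)
  qed
  moreover have "r 0 = s"
    using p by (simp add: r_def is_partition_def)
  moreover have "r (m + n) = u"
    using q by (simp add: rm is_partition_def)
  ultimately show thesis
    using step by (intro that [of r]) (simp_all add: is_partition_def)
qed

text \<open>The equation provides only integrals that start or end at \<open>t0\<close>. A fine
  partition of the remaining piece is completed by a fine partition of the known piece, so the
  missing integral exists as a difference, without any existence theory.\<close>

lemma has_young_integral_diff_left:
  assumes "s \<le> t" and I: "has_young_integral d W \<phi> s t I" and J: "has_young_integral d W \<phi> s u J"
  shows "has_young_integral d W \<phi> t u (J - I)"
  unfolding has_young_integral_def
proof (intro conjI allI impI)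
  show "J - I \<in> Rd d"
    using I J by (intro Rd_diff) (auto simp: has_young_integral_def)
  fix \<epsilon> :: real assume "0 < \<epsilon>"
  then have "0 < \<epsilon> / 2" by simp
  obtain \<delta> where \<delta>: "0 < \<delta>" "\<And>m p. is_partition s t m p \<and> (\<forall>i<m. p (Suc i) - p i < \<delta>) \<Longrightarrow>
      enorm d (young_sum W \<phi> m p - I) < \<epsilon> / 2"
    using I \<open>0 < \<epsilon> / 2\<close> unfolding has_young_integral_def by blast
  obtain \<delta>' where \<delta>': "0 < \<delta>'" "\<And>m p. is_partition s u m p \<and> (\<forall>i<m. p (Suc i) - p i < \<delta>') \<Longrightarrow>
      enorm d (young_sum W \<phi> m p - J) < \<epsilon> / 2"
    using J \<open>0 < \<epsilon> / 2\<close> unfolding has_young_integral_def by blast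
  show "\<exists>\<delta>>0. \<forall>n q. is_partition t u n q \<and> (\<forall>i<n. q (Suc i) - q i < \<delta>) \<longrightarrow>
      enorm d (young_sum W \<phi> n q - (J - I)) < \<epsilon>"
  proof (intro exI conjI allI impI)
    show "0 < min \<delta> \<delta>'"
      using \<delta> \<delta>' by simp
    fix n q assume q: "is_partition t u n q \<and> (\<forall>i<n. q (Suc i) - q i < min \<delta> \<delta>')"
    obtain m p where p: "is_partition s t m p" "\<forall>i<m. p (Suc i) - p i < min \<delta> \<delta>'"
      using fine_partition [of s t "min \<delta> \<delta>'"] assms \<delta> \<delta>' by auto
    obtain r where r: "is_partition s u (m + n) r" "\<forall>i<m+n. r (Suc i) - r i < min \<delta> \<delta>'"
      "young_sum W \<phi> (m + n) r = young_sum W \<phi> m p + young_sum W \<phi> n q"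
      using concat_partition [of s t m p u n q "min \<delta> \<delta>'"] p q by blast
    have eq: "young_sum W \<phi> n q - (J - I) = (young_sum W \<phi> (m + n) r - J) - (young_sum W \<phi> m p - I)"
      by (simp add: r)
    have "enorm d (young_sum W \<phi> (m + n) r - J) < \<epsilon> / 2"
      using r by (intro \<delta>') auto
    moreover have "enorm d (young_sum W \<phi> m p - I) < \<epsilon> / 2"
      using p by (intro \<delta>) auto
    ultimately show "enorm d (young_sum W \<phi> n q - (J - I)) < \<epsilon>"
      unfolding eq
      using enorm_triangle_diff [of d "young_sum W \<phi> (m + n) r - J" "young_sum W \<phi> m p - I"] by linarith
  qed
qed

lemma has_young_integral_diff_right:
  assumes "t \<le> u" and I: "has_young_integral d W \<phi> t u I" and J: "has_young_integral d W \<phi> s u J"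
  shows "has_young_integral d W \<phi> s t (J - I)"
  unfolding has_young_integral_def
proof (intro conjI allI impI)
  show "J - I \<in> Rd d"
    using I J by (intro Rd_diff) (auto simp: has_young_integral_def)
  fix \<epsilon> :: real assume "0 < \<epsilon>"
  then have "0 < \<epsilon> / 2" by simp
  obtain \<delta> where \<delta>: "0 < \<delta>" "\<And>m p. is_partition t u m p \<and> (\<forall>i<m. p (Suc i) - p i < \<delta>) \<Longrightarrow>
      enorm d (young_sum W \<phi> m p - I) < \<epsilon> / 2"
    using I \<open>0 < \<epsilon> / 2\<close> unfolding has_young_integral_def by blast
  obtain \<delta>' where \<delta>': "0 < \<delta>'" "\<And>m p. is_partition s u m p \<and> (\<forall>i<m. p (Suc i) - p i < \<delta>') \<Longrightarrow>
      enorm d (young_sum W \<phi> m p - J) < \<epsilon> / 2"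
    using J \<open>0 < \<epsilon> / 2\<close> unfolding has_young_integral_def by blast
  show "\<exists>\<delta>>0. \<forall>m p. is_partition s t m p \<and> (\<forall>i<m. p (Suc i) - p i < \<delta>) \<longrightarrow>
      enorm d (young_sum W \<phi> m p - (J - I)) < \<epsilon>"
  proof (intro exI conjI allI impI)
    show "0 < min \<delta> \<delta>'"
      using \<delta> \<delta>' by simp
    fix m p assume p: "is_partition s t m p \<and> (\<forall>i<m. p (Suc i) - p i < min \<delta> \<delta>')"
    obtain n q where q: "is_partition t u n q" "\<forall>i<n. q (Suc i) - q i < min \<delta> \<delta>'"
      using fine_partition [of t u "min \<delta> \<delta>'"] assms \<delta> \<delta>' by auto
    obtain r where r: "is_partition s u (m + n) r" "\<forall>i<m+n. r (Suc i) - r i < min \<delta> \<delta>'"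
      "young_sum W \<phi> (m + n) r = young_sum W \<phi> m p + young_sum W \<phi> n q"
      using concat_partition [of s t m p u n q "min \<delta> \<delta>'"] p q by blast
    have eq: "young_sum W \<phi> m p - (J - I) = (young_sum W \<phi> (m + n) r - J) - (young_sum W \<phi> n q - I)"
      by (simp add: r)
    have "enorm d (young_sum W \<phi> (m + n) r - J) < \<epsilon> / 2"
      using r by (intro \<delta>') auto
    moreover have "enorm d (young_sum W \<phi> n q - I) < \<epsilon> / 2"
      using q by (intro \<delta>) auto
    ultimately show "enorm d (young_sum W \<phi> m p - (J - I)) < \<epsilon>"
      unfolding eq
      using enorm_triangle_diff [of d "young_sum W \<phi> (m + n) r - J" "young_sum W \<phi> n q - I"] by linarith
  qed
qed

text \<open>Summed over a partition of mesh \<delta>, the one-step errors are at most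
  \<open>A * \<delta> powr (\<theta> - 1) * (t - s)\<close>, while the increments of
  \<open>\<phi>\<close> telescope. Existence and value of the integral come out together.\<close>

lemma has_young_integralI:
  assumes \<theta>: "1 < \<theta>" and A: "0 \<le> A" and "s \<le> t" and Rd: "\<phi> t - \<phi> s \<in> Rd d"
    and err: "\<And>x y. s \<le> x \<Longrightarrow> x < y \<Longrightarrow> y \<le> t \<Longrightarrow>
      enorm d (\<phi> y - \<phi> x - (W y (\<phi> x) - W x (\<phi> x))) \<le> A * (y - x) powr \<theta>"
  shows "has_young_integral d W \<phi> s t (\<phi> t - \<phi> s)"
  unfolding has_young_integral_def
proof (intro conjI allI impI Rd)
  fix \<epsilon> :: real assume \<epsilon>: "0 < \<epsilon>"
  define B where "B = A * (t - s)"
  have B: "0 \<le> B"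
    using A assms by (simp add: B_def)
  \<comment> \<open>Solves \<open>(B + 1) * \<delta> powr (\<theta> - 1) = \<epsilon>\<close>; the 1
    gives strictness and covers \<open>B = 0\<close>.\<close>
  define \<delta> where "\<delta> = (\<epsilon> / (B + 1)) powr (1 / (\<theta> - 1))"
  have \<delta>: "0 < \<delta>"
    using \<epsilon> B by (simp add: \<delta>_def)
  have "\<delta> powr (\<theta> - 1) = \<epsilon> / (B + 1)"
    using \<epsilon> B \<theta> by (simp add: \<delta>_def powr_powr)
  then have small: "B * \<delta> powr (\<theta> - 1) < \<epsilon>"
    using \<epsilon> B by (simp add: divide_less_eq algebra_simps)
  show "\<exists>\<delta>>0. \<forall>m p. is_partition s t m p \<and> (\<forall>i<m. p (Suc i) - p i < \<delta>) \<longrightarrow>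
      enorm d (young_sum W \<phi> m p - (\<phi> t - \<phi> s)) < \<epsilon>"
  proof (intro exI conjI allI impI)
    show "0 < \<delta>" by (fact \<delta>)
    fix m p assume "is_partition s t m p \<and> (\<forall>i<m. p (Suc i) - p i < \<delta>)"
    then have p: "is_partition s t m p" and mesh: "\<And>i. i < m \<Longrightarrow> p (Suc i) - p i < \<delta>"
      by auto
    have tele: "(\<Sum>i<k. \<phi> (p (Suc i)) - \<phi> (p i)) = \<phi> (p k) - \<phi> (p 0)" for k
      by (rule sum_lessThan_telescope)
    have "(\<phi> t - \<phi> s) - young_sum W \<phi> m p
        = (\<Sum>i<m. \<phi> (p (Suc i)) - \<phi> (p i) - (W (p (Suc i)) (\<phi> (p i)) - W (p i) (\<phi> (p i))))"
      using tele [of m] p by (simp add: young_sum_def is_partition_def sum_subtractf)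
    then have "enorm d (young_sum W \<phi> m p - (\<phi> t - \<phi> s))
        \<le> (\<Sum>i<m. enorm d (\<phi> (p (Suc i)) - \<phi> (p i) - (W (p (Suc i)) (\<phi> (p i)) - W (p i) (\<phi> (p i)))))"
      by (simp only: enorm_minus_commute [of d "young_sum W \<phi> m p"]) (rule enorm_sum_le)
    also have "\<dots> \<le> (\<Sum>i<m. A * \<delta> powr (\<theta> - 1) * (p (Suc i) - p i))"
    proof (rule sum_mono)
      fix i assume "i \<in> {..<m}"
      then have i: "i < m" by simp
      then have lt: "p i < p (Suc i)"
        using p by (simp add: is_partition_def)
      have "enorm d (\<phi> (p (Suc i)) - \<phi> (p i) - (W (p (Suc i)) (\<phi> (p i)) - W (p i) (\<phi> (p i))))
          \<le> A * (p (Suc i) - p i) powr \<theta>"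
        using is_partition_range [OF p, of i] is_partition_range [OF p, of "Suc i"] i lt
        by (intro err) auto
      also have "\<dots> = A * ((p (Suc i) - p i) powr (\<theta> - 1) * (p (Suc i) - p i))"
        using lt by (simp add: powr_mult_base powr_diff)
      also have "\<dots> \<le> A * (\<delta> powr (\<theta> - 1) * (p (Suc i) - p i))"
        using lt mesh [OF i] A \<theta> by (intro mult_left_mono mult_right_mono powr_mono2) auto
      finally show "enorm d (\<phi> (p (Suc i)) - \<phi> (p i) - (W (p (Suc i)) (\<phi> (p i)) - W (p i) (\<phi> (p i))))
          \<le> A * \<delta> powr (\<theta> - 1) * (p (Suc i) - p i)"
        by (simp add: mult.assoc)
    qed
    also have "\<dots> = A * \<delta> powr (\<theta> - 1) * (t - s)"
      using sum_lessThan_telescope [of p m] p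
      by (simp add: is_partition_def flip: sum_distrib_left)
    also have "\<dots> < \<epsilon>"
      using small by (simp add: B_def mult_ac)
    finally show "enorm d (young_sum W \<phi> m p - (\<phi> t - \<phi> s)) < \<epsilon>" .
  qed
qed

context young_field
begin

text \<open>The sums over uniform partitions converge to the increment of \<open>\<phi>\<close>, and
  \<open>grid_estimate\<close> for the sampled path has a bound free of the number of steps, so it
  survives the limit.\<close>

lemma davie_on_if_integral:
  assumes ce: "a \<le> c" "e \<le> b" and \<phi>: "\<And>t. t \<in> {c..e} \<Longrightarrow> \<phi> t \<in> Rd d"
    and int: "\<And>s t. c \<le> s \<Longrightarrow> s < t \<Longrightarrow> t \<le> e \<Longrightarrow> has_young_integral d W \<phi> s t (\<phi> t - \<phi> s)"
  shows "davie_on {c..e} \<phi>"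
  unfolding davie_on_def
proof (intro ballI impI allI)
  fix s t H S
  assume st: "s \<in> {c..e}" "t \<in> {c..e}" "s < t"
    and H: "holder_on ({c..e} \<inter> {s..t}) H \<phi>" and S: "\<forall>x\<in>{c..e} \<inter> {s..t}. 1 + enorm d (\<phi> x) \<le> S"
  define B where "B = K * N * S powr \<beta> * H powr lam * (t - s) powr \<theta>"
  show "enorm d (\<phi> t - \<phi> s - (W t (\<phi> s) - W s (\<phi> s))) \<le> B"
  proof (rule field_le_epsilon)
    fix \<epsilon> :: real assume "0 < \<epsilon>"
    then obtain \<delta> where \<delta>: "0 < \<delta>" "\<And>m p. is_partition s t m p \<and> (\<forall>i<m. p (Suc i) - p i < \<delta>) \<Longrightarrow>
        enorm d (young_sum W \<phi> m p - (\<phi> t - \<phi> s)) < \<epsilon>"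
      using int [of s t] st unfolding has_young_integral_def by (metis atLeastAtMost_iff)
    obtain n :: nat where n: "(t - s) / \<delta> < real n"
      using reals_Archimedean2 by blast
    define h where "h = (t - s) / real n"
    define p where "p = (\<lambda>i. s + real i * h)"
    have n0: "0 < real n"
      using n st \<delta> by (meson divide_pos_pos diff_gt_0_iff_gt less_trans)
    have h: "0 < h" "h < \<delta>"
      using n n0 st \<delta> by (auto simp: h_def divide_less_eq mult.commute)
    have p: "is_partition s t n p"
      using is_partition_uniform [of s t n] st n0 by (simp add: p_def h_def)
    have pn: "p 0 = s" "p n = t"
      using p by (auto simp: is_partition_def)
    have pin: "p i \<in> {c..e} \<inter> {s..t}" if "i \<le> n" for i
      using is_partition_range [OF p that] st by auto
    have small: "enorm d (young_sum W \<phi> n p - (\<phi> t - \<phi> s)) < \<epsilon>"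
      using p h by (intro \<delta>) (auto simp: p_def algebra_simps)
    have "enorm d ((\<Sum>i<n. W (p (Suc i)) (\<phi> (p i)) - W (p i) (\<phi> (p i)))
        - (W (p n) (\<phi> (p 0)) - W (p 0) (\<phi> (p 0)))) \<le> K * N * S powr \<beta> * H powr lam * (p n - p 0) powr \<theta>"
    proof (rule grid_estimate [OF h(1) p_def, where \<psi> = "\<lambda>i. \<phi> (p i)"])
      show "a \<le> s" "p n \<le> b"
        using st ce pn by auto
      show "\<phi> (p i) \<in> Rd d" "1 + enorm d (\<phi> (p i)) \<le> S" if "i \<le> n" for i
        using pin [OF that] S \<phi> by auto
      show "0 \<le> H"
        using H by (simp add: holder_on_def)
      show "enorm d (\<phi> (p j) - \<phi> (p i)) \<le> H * (p j - p i) powr \<tau>" if "i < j" "j \<le> n" for i j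
      proof -
        have "p i < p j"
          using that h by (simp add: p_def)
        then show ?thesis
          using H pin that by (simp add: holder_on_def)
      qed
    qed
    then have "enorm d (young_sum W \<phi> n p - (W t (\<phi> s) - W s (\<phi> s))) \<le> B"
      by (simp only: young_sum_def pn B_def)
    then have "enorm d ((young_sum W \<phi> n p - (W t (\<phi> s) - W s (\<phi> s))) - (young_sum W \<phi> n p - (\<phi> t - \<phi> s)))
        \<le> B + \<epsilon>"
      using small by (intro order_trans [OF enorm_triangle_diff]) linarith
    moreover have "(young_sum W \<phi> n p - (W t (\<phi> s) - W s (\<phi> s))) - (young_sum W \<phi> n p - (\<phi> t - \<phi> s))
      = \<phi> t - \<phi> s - (W t (\<phi> s) - W s (\<phi> s))"
      by simp
    ultimately show "enorm d (\<phi> t - \<phi> s - (W t (\<phi> s) - W s (\<phi> s))) \<le> B + \<epsilon>"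
      by simp
  qed
qed

end

subsection \<open>Euler schemes and their limits\<close>

text \<open>Tychonoff's theorem for a cube indexed by an arbitrary type. Pointwise convergence of a
  subsequence may fail for uncountable \<open>'a\<close>, hence a filter finer than
  \<open>sequentially\<close>; non-strict inequalities still pass to the limit along it.\<close>

lemma pointwise_cluster:
  fixes f :: "nat \<Rightarrow> 'a \<Rightarrow> real"
  assumes bound: "\<And>n x. \<bar>f n x\<bar> \<le> B"
  obtains F g where "F \<noteq> bot" "F \<le> sequentially" "\<And>x. ((\<lambda>n. f n x) \<longlongrightarrow> g x) F"
proof -
  define U where "U = PiE UNIV (\<lambda>_::'a. {-B..B})"
  have "compactin (product_topology (\<lambda>_::'a. euclidean) UNIV) U"
    unfolding U_def by (simp add: compactin_PiE)
  then have "compact U"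
    by (simp add: euclidean_product_topology)
  moreover have "eventually (\<lambda>h. h \<in> U) (filtermap f sequentially)"
    using bound by (auto simp: eventually_filtermap U_def abs_le_iff minus_le_iff PiE_iff)
  moreover have "filtermap f sequentially \<noteq> bot"
    by (simp add: filtermap_bot_iff)
  ultimately obtain g where g: "inf (nhds g) (filtermap f sequentially) \<noteq> bot"
    unfolding compact_filter by blast
  \<comment> \<open>Indices \<open>n\<close> that are large and have \<open>f n\<close> near
    \<open>g\<close>; the filter is proper because \<open>g\<close> is a cluster point.\<close>
  define F where "F = inf (filtercomap f (nhds g)) sequentially"
  have "F \<noteq> bot"
  proof
    assume "F = bot"
    then have "eventually (\<lambda>_. False) F"
      by simp
    then obtain P Q where P: "eventually P (nhds g)" and Q: "eventually Q sequentially"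
      and PQ: "\<And>n. P (f n) \<Longrightarrow> Q n \<Longrightarrow> False"
      unfolding F_def eventually_inf eventually_filtercomap by blast
    have "eventually (\<lambda>h. \<not> P h) (filtermap f sequentially)"
      unfolding eventually_filtermap using Q by eventually_elim (use PQ in blast)
    then have "eventually (\<lambda>_. False) (inf (nhds g) (filtermap f sequentially))"
      unfolding eventually_inf using P by blast
    with g show False
      by (simp add: trivial_limit_def)
  qed
  moreover have "F \<le> sequentially"
    by (simp add: F_def)
  moreover have "((\<lambda>n. f n x) \<longlongrightarrow> g x) F" for x
  proof -
    have "filterlim f (nhds g) F"
      unfolding F_def filterlim_def by (rule order_trans [OF filtermap_mono [OF inf_le1] filtermap_filtercomap])
    moreover have "continuous_on UNIV (\<lambda>h::'a \<Rightarrow> real. h x)"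
      by (rule continuous_on_product_coordinates)
    then have "((\<lambda>h::'a \<Rightarrow> real. h x) \<longlongrightarrow> g x) (nhds g)"
      using tendsto_at_iff_tendsto_nhds [of "\<lambda>h::'a \<Rightarrow> real. h x" g] by (simp add: continuous_on_def)
    ultimately show ?thesis
      by (rule filterlim_compose [rotated])
  qed
  ultimately show thesis
    using that by blast
qed

context young_field
begin

definition grid :: "nat \<Rightarrow> nat \<Rightarrow> real" where
  "grid n i = a + real i * ((b - a) / n)"

lemma grid_ends [simp]: "grid n 0 = a" "0 < n \<Longrightarrow> grid n n = b"
  by (simp_all add: grid_def)

lemma grid_less_iff: "a < b \<Longrightarrow> 0 < n \<Longrightarrow> grid n i < grid n j \<longleftrightarrow> i < j"
  by (simp add: grid_def mult_less_cancel_right divide_less_cancel)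

lemma grid_diff: "i \<le> j \<Longrightarrow> grid n j - grid n i = real (j - i) * ((b - a) / n)"
  by (simp add: grid_def of_nat_diff left_diff_distrib diff_divide_distrib)

lemma grid_mem:
  assumes "a < b" "0 < n" "i \<le> n"
  shows "grid n i \<in> {a..b}"
  using grid_less_iff [OF assms(1,2), of i 0] grid_less_iff [OF assms(1,2), of n i] assms
  by auto

text \<open>By its recursion the scheme has increments equal to the sums in
  \<open>grid_estimate\<close>, so it satisfies the one-step estimate on its grid with no error
  term.\<close>

lemma euler_scheme:
  assumes ab: "a < b" and n: "0 < n" and v: "v \<in> Rd d"
  defines "G \<equiv> grid n ` {..n}"
  obtains \<Phi> H0 where "davie_on G \<Phi>" "holder_on G H0 \<Phi>" "\<Phi> a = v" "\<And>t. t \<in> G \<Longrightarrow> \<Phi> t \<in> Rd d"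
proof -
  define p where "p = grid n"
  define \<psi> where "\<psi> = rec_nat v (\<lambda>i x. x + (W (p (Suc i)) x - W (p i) x))"
  have \<psi>0: "\<psi> 0 = v" and \<psi>Suc: "\<psi> (Suc i) - \<psi> i = W (p (Suc i)) (\<psi> i) - W (p i) (\<psi> i)" for i
    by (simp_all add: \<psi>_def)
  have \<psi>Rd: "\<psi> i \<in> Rd d" for i
  proof (induction i)
    case (Suc i)
    then have "\<psi> i + (W (p (Suc i)) (\<psi> i) - W (p i) (\<psi> i)) \<in> Rd d"
      by (intro Rd_add Rd_diff maps)
    then show ?case
      by (simp flip: \<psi>Suc)
  qed (simp add: \<psi>0 v)
  have pinj: "p i = p j \<longleftrightarrow> i = j" for i j
    using grid_less_iff [OF ab n, of i j] grid_less_iff [OF ab n, of j i]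
    by (auto simp: p_def linorder_neq_iff)
  \<comment> \<open>Meaningful at grid points only, where \<open>pinj\<close> makes the index
    unique.\<close>
  define \<Phi> where "\<Phi> t = \<psi> (THE i. p i = t)" for t
  have \<Phi>: "\<Phi> (p i) = \<psi> i" for i
    by (simp add: \<Phi>_def pinj)
  have "davie_on G \<Phi>"
    unfolding davie_on_def
  proof (intro ballI impI allI)
    fix s t H S
    assume st: "s \<in> G" "t \<in> G" "s < t"
      and H: "holder_on (G \<inter> {s..t}) H \<Phi>" and S: "\<forall>x\<in>G \<inter> {s..t}. 1 + enorm d (\<Phi> x) \<le> S"
    obtain i j where ij: "s = p i" "t = p j" "i < j" "j \<le> n"
      using st ab n by (auto simp: G_def p_def grid_less_iff)
    define m where "m = j - i"
    define q where "q = (\<lambda>k. p i + real k * ((b - a) / n))"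
    have q: "q k = p (i + k)" for k
      by (simp add: q_def p_def grid_def distrib_right add_divide_distrib)
    have im: "i + m = j"
      using ij by (simp add: m_def)
    have mem: "p (i + k) \<in> G \<inter> {s..t}" if "k \<le> m" for k
      using that ij im grid_less_iff [OF ab n, of "i + k" i] grid_less_iff [OF ab n, of j "i + k"]
      by (auto simp: G_def p_def not_less [symmetric])
    have "enorm d ((\<Sum>k<m. W (q (Suc k)) (\<psi> (i + k)) - W (q k) (\<psi> (i + k)))
        - (W (q m) (\<psi> (i + 0)) - W (q 0) (\<psi> (i + 0)))) \<le> K * N * S powr \<beta> * H powr lam * (q m - q 0) powr \<theta>"
    proof (rule grid_estimate [OF _ q_def, where \<psi> = "\<lambda>k. \<psi> (i + k)"])
      show "0 < (b - a) / n"
        using ab n by simp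
      show "a \<le> p i" "q m \<le> b"
        using grid_mem [OF ab n, of i] grid_mem [OF ab n, of j] ij by (auto simp: q im p_def)
      show "\<psi> (i + k) \<in> Rd d" for k
        by (rule \<psi>Rd)
      show "1 + enorm d (\<psi> (i + k)) \<le> S" if "k \<le> m" for k
        using S mem [OF that] by (force simp: \<Phi>)
      show "0 \<le> H"
        using H by (simp add: holder_on_def)
      show "enorm d (\<psi> (i + l) - \<psi> (i + k)) \<le> H * (q l - q k) powr \<tau>" if "k < l" "l \<le> m" for k l
      proof -
        have "p (i + k) < p (i + l)"
          using that ab n by (simp add: p_def grid_less_iff)
        then have "enorm d (\<Phi> (p (i + l)) - \<Phi> (p (i + k))) \<le> H * (p (i + l) - p (i + k)) powr \<tau>"
          using H mem [of k] mem [of l] that unfolding holder_on_def by (meson less_imp_le order_trans)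
        then show ?thesis
          by (simp add: \<Phi> q)
      qed
    qed
    moreover have "(\<Sum>k<m. W (q (Suc k)) (\<psi> (i + k)) - W (q k) (\<psi> (i + k))) = \<psi> j - \<psi> i"
      using sum_lessThan_telescope [of "\<lambda>k. \<psi> (i + k)" m] by (simp add: q \<psi>Suc im)
    ultimately show "enorm d (\<Phi> t - \<Phi> s - (W t (\<Phi> s) - W s (\<Phi> s)))
        \<le> K * N * S powr \<beta> * H powr lam * (t - s) powr \<theta>"
      by (simp add: q im ij \<Phi>)
  qed
  moreover have "\<exists>H0. holder_on G H0 \<Phi>"
  proof -
    \<comment> \<open>Any Hoelder constant will do for absorption, even one that depends on the
      grid; finiteness of \<open>G\<close> supplies it.\<close>
    have "finite ((\<lambda>(x, y). enorm d (\<Phi> y - \<Phi> x) / (y - x) powr \<tau>) ` (G \<times> G))"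
      by (simp add: G_def)
    then obtain B where B: "\<And>x y. x \<in> G \<Longrightarrow> y \<in> G \<Longrightarrow> enorm d (\<Phi> y - \<Phi> x) / (y - x) powr \<tau> \<le> B"
      using bdd_above_finite [of "(\<lambda>(x, y). enorm d (\<Phi> y - \<Phi> x) / (y - x) powr \<tau>) ` (G \<times> G)"]
      by (fastforce simp: bdd_above_def)
    have "holder_on G \<bar>B\<bar> \<Phi>"
      unfolding holder_on_def
    proof (intro conjI ballI impI)
      fix x y assume "x \<in> G" "y \<in> G" "x < y"
      then show "enorm d (\<Phi> y - \<Phi> x) \<le> \<bar>B\<bar> * (y - x) powr \<tau>"
        using B [of x y] by (simp add: divide_le_eq) (metis abs_ge_self mult_right_mono order_trans powr_ge_zero)
    qed simp
    then show ?thesis by blast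
  qed
  moreover have "\<Phi> a = v"
    using \<Phi> [of 0] by (simp add: \<psi>0 p_def)
  moreover have "\<Phi> t \<in> Rd d" if "t \<in> G" for t
    using that by (auto simp: G_def \<Phi> \<psi>Rd simp flip: p_def)
  ultimately show thesis
    using that by blast
qed

text \<open>Joint continuity, needed because the time is a moving grid point and the position a
  moving approximation.\<close>

lemma W_tendsto:
  assumes s: "\<And>n. s n \<in> {a..b}" "(s \<longlongrightarrow> t) F" "t \<in> {a..b}"
    and x: "\<And>n. x n \<in> Rd d" "y \<in> Rd d" "((\<lambda>n. enorm d (x n - y)) \<longlongrightarrow> 0) F"
  shows "((\<lambda>n. enorm d (W (s n) (x n) - W t y)) \<longlongrightarrow> 0) F"
proof (rule real_tendsto_sandwich [OF _ _ tendsto_const])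
  show "\<forall>\<^sub>F n in F. 0 \<le> enorm d (W (s n) (x n) - W t y)"
    by simp
  \<comment> \<open>The size of \<open>x n\<close> is replaced by
    \<open>enorm d y + enorm d (x n - y)\<close>, so that the bound involves only the two null
    quantities.\<close>
  let ?u = "\<lambda>n. N * (1 + (enorm d y + enorm d (x n - y)) + enorm d y) powr \<beta> * enorm d (x n - y) powr lam
      + N * (1 + enorm d y) powr (\<beta> + lam) * \<bar>s n - t\<bar> powr \<tau>"
  have "enorm d (W (s n) (x n) - W t y) \<le> ?u n" for n
  proof -
    have "enorm d (W (s n) (x n) - W (s n) y) \<le> N * (1 + enorm d (x n) + enorm d y) powr \<beta> * enorm d (x n - y) powr lam"
      using s x by (intro space) auto
    also have "\<dots> \<le> N * (1 + (enorm d y + enorm d (x n - y)) + enorm d y) powr \<beta> * enorm d (x n - y) powr lam"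
      using enorm_le_add_diff [of d "x n" y] N_nonneg beta_nonneg
      by (intro mult_right_mono mult_left_mono powr_mono2) (auto intro!: add_nonneg_nonneg)
    finally show ?thesis
      using s x by (intro enorm_triangle_le [of _ "W (s n) (x n) - W (s n) y" "W (s n) y - W t y"] time) auto
  qed
  then show "\<forall>\<^sub>F n in F. enorm d (W (s n) (x n) - W t y) \<le> ?u n"
    by simp
  have 1: "((\<lambda>n. \<bar>s n - t\<bar> powr \<tau>) \<longlongrightarrow> 0) F"
    using s(2) tau_pos by (intro tendsto_zero_powrI [where b = \<tau>] tendsto_rabs_zero tendsto_const) (auto simp: LIM_zero_iff)
  have 2: "((\<lambda>n. enorm d (x n - y) powr lam) \<longlongrightarrow> 0) F"
    using x(3) lam_pos by (intro tendsto_zero_powrI [where b = lam] tendsto_const) auto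
  have 3: "((\<lambda>n. (1 + (enorm d y + enorm d (x n - y)) + enorm d y) powr \<beta>)
      \<longlongrightarrow> (1 + (enorm d y + 0) + enorm d y) powr \<beta>) F"
    by (intro tendsto_powr tendsto_add tendsto_const x) (use enorm_nonneg [of d y] in linarith)
  have "(?u \<longlongrightarrow> N * (1 + (enorm d y + 0) + enorm d y) powr \<beta> * 0 + N * (1 + enorm d y) powr (\<beta> + lam) * 0) F"
    by (intro tendsto_add tendsto_mult tendsto_const 1 2 3)
  then show "(?u \<longlongrightarrow> 0) F"
    by simp
qed

text \<open>The domains \<open>G n\<close> vary, so approximations are compared at a common time
  \<open>t\<close> through \<open>\<rho> n t\<close>. As \<open>S\<close>, \<open>H\<close> and
  \<open>A\<close> do not depend on \<open>n\<close>, pointwise convergence is enough for every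
  estimate.\<close>

lemma approximate_solutions_limit:
  assumes ab: "a < b" and G: "\<And>n. G n \<subseteq> {a..b}"
    and \<rho>: "\<And>n t. t \<in> {a..b} \<Longrightarrow> \<rho> n t \<in> G n" "\<And>t. t \<in> {a..b} \<Longrightarrow> (\<lambda>n. \<rho> n t) \<longlonglongrightarrow> t"
      "\<And>n. \<rho> n a = a"
    and \<Phi>: "\<And>n. \<Phi> n a = v" "\<And>n t. t \<in> G n \<Longrightarrow> \<Phi> n t \<in> Rd d"
      "\<And>n t. t \<in> G n \<Longrightarrow> enorm d (\<Phi> n t) \<le> S" "\<And>n. holder_on (G n) H (\<Phi> n)"
    and err: "\<And>n s t. s \<in> G n \<Longrightarrow> t \<in> G n \<Longrightarrow> s < t \<Longrightarrow>
      enorm d (\<Phi> n t - \<Phi> n s - (W t (\<Phi> n s) - W s (\<Phi> n s))) \<le> A * (t - s) powr \<theta>"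
  obtains \<phi> where "\<phi> a = v" "\<And>t. t \<in> {a..b} \<Longrightarrow> \<phi> t \<in> Rd d" "holder_on {a..b} H \<phi>"
    "\<And>s t. a \<le> s \<Longrightarrow> s < t \<Longrightarrow> t \<le> b \<Longrightarrow>
      enorm d (\<phi> t - \<phi> s - (W t (\<phi> s) - W s (\<phi> s))) \<le> A * (t - s) powr \<theta>"
proof -
  \<comment> \<open>Time and coordinate form one index, so a single filter serves all of them; the
    value 0 off the interval keeps the bound \<open>S\<close> global.\<close>
  define f where "f n = (\<lambda>(t, i). if t \<in> {a..b} then \<Phi> n (\<rho> n t) i else 0)" for n
  have S: "0 \<le> S"
    using order_trans [OF enorm_nonneg \<Phi>(3) [OF \<rho>(1), of a 0]] ab by simp
  have "\<bar>f n x\<bar> \<le> S" for n x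
  proof (cases x)
    case (Pair t i)
    show ?thesis
    proof (cases "t \<in> {a..b} \<and> i < d")
      case True
      then show ?thesis
        using abs_component_le_enorm [of i d "\<Phi> n (\<rho> n t)"] \<Phi>(3) [OF \<rho>(1), of t n] Pair
        by (simp add: f_def)
    next
      case False
      then have "f n x = 0"
        using \<Phi>(2) [OF \<rho>(1), of t n] Pair by (auto simp: f_def Rd_iff)
      then show ?thesis
        using S by simp
    qed
  qed
  then obtain F g where F: "F \<noteq> bot" "F \<le> sequentially" and g: "\<And>x. ((\<lambda>n. f n x) \<longlongrightarrow> g x) F"
    using pointwise_cluster [of f S] by blast
  define \<phi> where "\<phi> t i = g (t, i)" for t i
  define x where "x t n = \<Phi> n (\<rho> n t)" for t n
  have lim: "((\<lambda>n. x t n i) \<longlongrightarrow> \<phi> t i) F" if "t \<in> {a..b}" for t i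
    using g [of "(t, i)"] that by (simp add: f_def \<phi>_def x_def)
  have xRd: "x t n \<in> Rd d" if "t \<in> {a..b}" for t n
    using that \<Phi> \<rho> by (simp add: x_def)
  have \<phi>Rd: "\<phi> t \<in> Rd d" if "t \<in> {a..b}" for t
    unfolding Rd_iff
  proof (intro allI impI)
    fix i assume "d \<le> i"
    then have "x t n i = 0" for n
      using xRd [OF that, of n] by (simp add: Rd_iff)
    then show "\<phi> t i = 0"
      using lim [OF that, of i] F(1) by (simp add: tendsto_const_iff)
  qed
  have dist: "((\<lambda>n. enorm d (x t n - \<phi> t)) \<longlongrightarrow> 0) F" if "t \<in> {a..b}" for t
    using tendsto_enorm [of d "\<lambda>n. x t n - \<phi> t" 0 F] lim [OF that] by (simp add: LIM_zero)
  have \<rho>F: "((\<lambda>n. \<rho> n t) \<longlongrightarrow> t) F" if "t \<in> {a..b}" for t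
    using \<rho>(2) [OF that] F(2) by (rule tendsto_mono [rotated])
  have \<rho>mem: "\<rho> n t \<in> {a..b}" if "t \<in> {a..b}" for n t
    using \<rho>(1) [OF that] G by blast
  have Wlim: "((\<lambda>n. W (\<rho> n u) (x t n) i) \<longlongrightarrow> W u (\<phi> t) i) F" if "t \<in> {a..b}" "u \<in> {a..b}" "i < d" for t u i
    by (intro tendsto_component [OF W_tendsto that(3)] \<rho>mem \<rho>F xRd \<phi>Rd dist that)
  \<comment> \<open>Rounding could merge two times, but the estimates for \<open>\<Phi> n\<close>
    require strict order.\<close>
  have less: "\<forall>\<^sub>F n in F. \<rho> n s < \<rho> n t" if "s \<in> {a..b}" "t \<in> {a..b}" "s < t" for s t
    using order_tendstoD(2) [OF \<rho>F [OF that(1)], of "(s + t) / 2"]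
      order_tendstoD(1) [OF \<rho>F [OF that(2)], of "(s + t) / 2"] that
    by (auto elim: eventually_elim2)
  have pow: "((\<lambda>n. c * (\<rho> n t - \<rho> n s) powr q) \<longlongrightarrow> c * (t - s) powr q) F"
    if "s \<in> {a..b}" "t \<in> {a..b}" "s < t" for s t c q
    using that by (intro tendsto_intros \<rho>F) auto
  show thesis
  proof (rule that)
    have "x a n = v" for n
      using \<Phi>(1) \<rho>(3) by (simp add: x_def)
    then show "\<phi> a = v"
      using lim [of a] ab F(1) by (simp add: fun_eq_iff tendsto_const_iff)
    show "holder_on {a..b} H \<phi>"
      unfolding holder_on_def
    proof (intro conjI ballI impI)
      show "0 \<le> H"
        using \<Phi>(4) by (simp add: holder_on_def)
      fix s t assume st: "s \<in> {a..b}" "t \<in> {a..b}" "s < t"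
      show "enorm d (\<phi> t - \<phi> s) \<le> H * (t - s) powr \<tau>"
      proof (rule tendsto_le [OF F(1) pow [OF st]])
        show "((\<lambda>n. enorm d (x t n - x s n)) \<longlongrightarrow> enorm d (\<phi> t - \<phi> s)) F"
          using lim st by (intro tendsto_enorm) (auto intro: tendsto_diff)
        show "\<forall>\<^sub>F n in F. enorm d (x t n - x s n) \<le> H * (\<rho> n t - \<rho> n s) powr \<tau>"
          using less [OF st]
        proof eventually_elim
          case (elim n)
          then show ?case
            using \<Phi>(4) [of n] \<rho>(1) st by (simp add: holder_on_def x_def)
        qed
      qed
    qed
    fix s t assume "a \<le> s" "s < t" "t \<le> b"
    then have st: "s \<in> {a..b}" "t \<in> {a..b}" "s < t"
      by auto
    show "enorm d (\<phi> t - \<phi> s - (W t (\<phi> s) - W s (\<phi> s))) \<le> A * (t - s) powr \<theta>"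
    proof (rule tendsto_le [OF F(1) pow [OF st]])
      show "((\<lambda>n. enorm d (x t n - x s n - (W (\<rho> n t) (x s n) - W (\<rho> n s) (x s n))))
          \<longlongrightarrow> enorm d (\<phi> t - \<phi> s - (W t (\<phi> s) - W s (\<phi> s)))) F"
        using lim Wlim st by (intro tendsto_enorm) (auto intro!: tendsto_diff)
      show "\<forall>\<^sub>F n in F. enorm d (x t n - x s n - (W (\<rho> n t) (x s n) - W (\<rho> n s) (x s n)))
          \<le> A * (\<rho> n t - \<rho> n s) powr \<theta>"
        using less [OF st]
      proof eventually_elim
        case (elim n)
        then show ?case
          using err \<rho>(1) st by (simp add: x_def)
      qed
    qed
  qed (fact \<phi>Rd)
qed

lemma forward_solution:
  assumes ab: "a < b" and v: "v \<in> Rd d"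
  obtains \<phi> H A where "\<phi> a = v" "\<And>t. t \<in> {a..b} \<Longrightarrow> \<phi> t \<in> Rd d" "holder_on {a..b} H \<phi>" "0 \<le> A"
    "\<And>s t. a \<le> s \<Longrightarrow> s < t \<Longrightarrow> t \<le> b \<Longrightarrow>
      enorm d (\<phi> t - \<phi> s - (W t (\<phi> s) - W s (\<phi> s))) \<le> A * (t - s) powr \<theta>"
proof -
  obtain M :: nat where M: "0 < M" "N * ((b - a) / M) powr \<tau> * (1 + K) \<le> 1 / 2"
    using step_exists [of "b - a"] ab by auto
  \<comment> \<open>A multiple of \<open>M\<close>: each step of length \<open>(b - a) / M\<close>
    consists of \<open>Suc n\<close> grid steps, so every grid admits chains of the same length
    \<open>M\<close> and the bounds are uniform in \<open>n\<close>.\<close>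
  define m where "m n = M * Suc n" for n
  define G where "G n = grid (m n) ` {..m n}" for n
  define S where "S = 2 ^ M * (1 + enorm d v)"
  define H where "H = 2 * S / ((b - a) / M) powr \<tau>"
  define A where "A = K * N * S powr \<beta> * H powr lam"
  have m: "0 < m n" for n
    using M by (simp add: m_def)
  have m_real: "real (m n) = real M * real (Suc n)" for n
    by (simp only: m_def of_nat_mult)
  have G: "G n \<subseteq> {a..b}" for n
    using grid_mem [OF ab m] by (auto simp: G_def)
  have "\<exists>\<Phi>. \<Phi> a = v \<and> (\<forall>t\<in>G n. \<Phi> t \<in> Rd d) \<and> davie_on (G n) \<Phi> \<and>
      (\<forall>t\<in>G n. 1 + enorm d (\<Phi> t) \<le> S) \<and> holder_on (G n) H \<Phi>" for n
  proof -
    obtain \<Phi> H0 where \<Phi>: "davie_on (G n) \<Phi>" "holder_on (G n) H0 \<Phi>" "\<Phi> a = v" "\<And>t. t \<in> G n \<Longrightarrow> \<Phi> t \<in> Rd d"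
      using euler_scheme [OF ab m [of n] v] unfolding G_def by blast
    have chain: "\<exists>x. x 0 = a \<and> x M = t \<and> (\<forall>k\<le>M. x k \<in> G n) \<and> (\<forall>k<M. \<bar>x (Suc k) - x k\<bar> \<le> (b - a) / M)"
      if t: "t \<in> G n" for t
    proof -
      obtain j where j: "j \<le> m n" "t = grid (m n) j"
        using t by (auto simp: G_def)
      \<comment> \<open>Advances by \<open>Suc n\<close> indices and waits at \<open>j\<close> once
        it is reached.\<close>
      define x where "x k = grid (m n) (min j (k * Suc n))" for k
      have "\<bar>x (Suc k) - x k\<bar> \<le> (b - a) / M" for k
      proof -
        have "x (Suc k) - x k = real (min j (Suc k * Suc n) - min j (k * Suc n)) * ((b - a) / m n)"
          unfolding x_def by (intro grid_diff) auto
        then have "\<bar>x (Suc k) - x k\<bar> = real (min j (Suc k * Suc n) - min j (k * Suc n)) * ((b - a) / m n)"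
          using ab by simp
        also have "\<dots> \<le> real (Suc n) * ((b - a) / m n)"
          using ab by (intro mult_right_mono) auto
        also have "\<dots> = (b - a) / M"
          by (simp add: m_real del: of_nat_Suc)
        finally show ?thesis .
      qed
      moreover have "x 0 = a" "x M = t" "\<forall>k\<le>M. x k \<in> G n"
        using j by (auto simp: x_def m_def G_def min_def)
      ultimately show ?thesis by blast
    qed
    have "0 < (b - a) / M"
      using ab M by simp
    from global_bound [OF G \<Phi>(4,1,2) this M(2) chain] show ?thesis
      using \<Phi> unfolding H_def S_def by blast
  qed
  then obtain \<Phi> where \<Phi>: "\<And>n. \<Phi> n a = v" "\<And>n t. t \<in> G n \<Longrightarrow> \<Phi> n t \<in> Rd d" "\<And>n. davie_on (G n) (\<Phi> n)"
      "\<And>n t. t \<in> G n \<Longrightarrow> 1 + enorm d (\<Phi> n t) \<le> S" "\<And>n. holder_on (G n) H (\<Phi> n)"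
    by metis
  have err: "enorm d (\<Phi> n t - \<Phi> n s - (W t (\<Phi> n s) - W s (\<Phi> n s))) \<le> A * (t - s) powr \<theta>"
    if "s \<in> G n" "t \<in> G n" "s < t" for n s t
  proof -
    have "holder_on (G n \<inter> {s..t}) H (\<Phi> n)" "\<forall>x\<in>G n \<inter> {s..t}. 1 + enorm d (\<Phi> n x) \<le> S"
      using \<Phi>(4,5) by (auto intro: holder_on_subset)
    then show ?thesis
      using \<Phi>(3) that unfolding davie_on_def A_def by blast
  qed
  define h where "h n = (b - a) / m n" for n
  have h: "0 < h n" for n
    using ab m by (simp add: h_def)
  \<comment> \<open>Rounds down to the grid, which fixes \<open>a\<close> and errs by at most the
    mesh \<open>h n\<close>.\<close>
  define \<rho> where "\<rho> n t = grid (m n) (nat \<lfloor>(t - a) / h n\<rfloor>)" for n t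
  have \<rho>1: "\<rho> n t \<in> G n" if "t \<in> {a..b}" for n t
  proof -
    have "(t - a) / h n \<le> (b - a) / h n"
      using that h by (intro divide_right_mono) (auto simp: less_imp_le)
    also have "\<dots> = real (m n)"
      using ab m [of n] by (simp add: h_def)
    finally have "nat \<lfloor>(t - a) / h n\<rfloor> \<le> m n"
      by linarith
    then show ?thesis
      by (simp add: \<rho>_def G_def)
  qed
  have "h \<longlonglongrightarrow> 0"
  proof -
    have "(\<lambda>n. (b - a) / M * inverse (real (Suc n))) \<longlonglongrightarrow> (b - a) / M * 0"
      by (intro tendsto_mult tendsto_const LIMSEQ_inverse_real_of_nat)
    moreover have "h = (\<lambda>n. (b - a) / M * inverse (real (Suc n)))"
      by (simp add: h_def m_real fun_eq_iff divide_inverse mult_ac del: of_nat_Suc)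
    ultimately show ?thesis by simp
  qed
  have \<rho>2: "(\<lambda>n. \<rho> n t) \<longlonglongrightarrow> t" if "t \<in> {a..b}" for t
  proof -
    have "norm (\<rho> n t - t) \<le> h n" for n
    proof -
      define y where "y = (t - a) / h n"
      have y: "0 \<le> y" "t = a + y * h n"
        using that h [of n] by (auto simp: y_def)
      have "\<rho> n t - t = (real (nat \<lfloor>y\<rfloor>) - y) * h n"
        using y(2) by (simp add: \<rho>_def grid_def left_diff_distrib flip: y_def h_def)
      moreover have "\<bar>real (nat \<lfloor>y\<rfloor>) - y\<bar> \<le> 1"
        using y(1) by linarith
      ultimately show ?thesis
        using h [of n] mult_right_mono [of "\<bar>real (nat \<lfloor>y\<rfloor>) - y\<bar>" 1 "h n"] by (simp add: abs_mult)
    qed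
    then have "(\<lambda>n. \<rho> n t - t) \<longlonglongrightarrow> 0"
      by (intro Lim_null_comparison [OF _ \<open>h \<longlonglongrightarrow> 0\<close>] always_eventually allI)
    then show ?thesis
      by (simp add: LIM_zero_iff)
  qed
  have \<rho>3: "\<rho> n a = a" for n
    by (simp add: \<rho>_def)
  have bound: "enorm d (\<Phi> n t) \<le> S" if "t \<in> G n" for n t
    using \<Phi>(4) [OF that] by simp
  obtain \<phi> where "\<phi> a = v" "\<And>t. t \<in> {a..b} \<Longrightarrow> \<phi> t \<in> Rd d" "holder_on {a..b} H \<phi>"
    "\<And>s t. a \<le> s \<Longrightarrow> s < t \<Longrightarrow> t \<le> b \<Longrightarrow>
      enorm d (\<phi> t - \<phi> s - (W t (\<phi> s) - W s (\<phi> s))) \<le> A * (t - s) powr \<theta>"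
    using approximate_solutions_limit [of G \<rho> \<Phi> v S H A, OF ab G \<rho>1 \<rho>2 \<rho>3 \<Phi>(1,2) bound \<Phi>(5) err] by blast
  moreover have "0 \<le> A"
    using K_pos N_nonneg by (simp add: A_def)
  ultimately show thesis
    using that by blast
qed

lemma backward_solution:
  assumes ab: "a < b" and v: "v \<in> Rd d"
  obtains \<phi> H A where "\<phi> b = v" "\<And>t. t \<in> {a..b} \<Longrightarrow> \<phi> t \<in> Rd d" "holder_on {a..b} H \<phi>" "0 \<le> A"
    "\<And>s t. a \<le> s \<Longrightarrow> s < t \<Longrightarrow> t \<le> b \<Longrightarrow>
      enorm d (\<phi> t - \<phi> s - (W t (\<phi> s) - W s (\<phi> s))) \<le> A * (t - s) powr \<theta>"
proof -
  interpret rev: young_field d \<beta> \<tau> lam N "- b" "- a" "\<lambda>t. W (- t)"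
  proof (unfold_locales, goal_cases)
    case (10 s t x y)
    then show ?case
      using mixed [of "- s" "- t" x y] by (simp add: abs_minus_commute)
  next
    case (11 s t x)
    then show ?case
      using time [of "- s" "- t" x] by (simp add: abs_minus_commute)
  next
    case (12 t x y)
    then show ?case
      using space [of "- t" x y] by simp
  qed (fact tau_pos tau_le lam_pos lam_le young beta_nonneg beta_lam N_nonneg | erule maps)+
  obtain \<psi> H A where \<psi>: "\<psi> (- b) = v" "\<And>t. t \<in> {- b..- a} \<Longrightarrow> \<psi> t \<in> Rd d" "holder_on {- b..- a} H \<psi>" "0 \<le> A"
    and err: "\<And>s t. - b \<le> s \<Longrightarrow> s < t \<Longrightarrow> t \<le> - a \<Longrightarrow>
      enorm d (\<psi> t - \<psi> s - (W (- t) (\<psi> s) - W (- s) (\<psi> s))) \<le> A * (t - s) powr \<theta>"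
    using rev.forward_solution [of v] ab v by auto
  define \<phi> where "\<phi> t = \<psi> (- t)" for t
  have H: "holder_on {a..b} H \<phi>"
    unfolding holder_on_def
  proof (intro conjI ballI impI)
    show "0 \<le> H"
      using \<psi>(3) by (simp add: holder_on_def)
    fix s t assume "s \<in> {a..b}" "t \<in> {a..b}" "s < t"
    then show "enorm d (\<phi> t - \<phi> s) \<le> H * (t - s) powr \<tau>"
      using holder_on_abs [OF \<psi>(3), of "- t" "- s"]
      by (simp add: \<phi>_def enorm_minus_commute [of d "\<psi> (- t)"])
  qed
  have \<phi>Rd: "\<phi> t \<in> Rd d" if "t \<in> {a..b}" for t
    using that \<psi>(2) by (simp add: \<phi>_def)
  \<comment> \<open>A crude bound from the Hoelder constant suffices: existence needs some finite
    \<open>B\<close>, not a controlled one.\<close>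
  obtain S where S: "\<And>t. t \<in> {a..b} \<Longrightarrow> 1 + enorm d (\<phi> t) \<le> S"
  proof
    fix t assume t: "t \<in> {a..b}"
    have "enorm d (\<phi> t) \<le> enorm d (\<phi> a) + enorm d (\<phi> t - \<phi> a)"
      by (rule enorm_le_add_diff)
    moreover have "enorm d (\<phi> t - \<phi> a) \<le> H * \<bar>t - a\<bar> powr \<tau>"
      using holder_on_abs [OF H, of a t] t by simp
    moreover have "\<dots> \<le> H * (b - a) powr \<tau>"
      using t H tau_pos by (intro mult_left_mono powr_mono2) (auto simp: holder_on_def)
    ultimately show "1 + enorm d (\<phi> t) \<le> 1 + enorm d (\<phi> a) + H * (b - a) powr \<tau>"
      by linarith
  qed
  define B where "B = A + 2 * N * S powr \<beta> * H powr lam"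
  \<comment> \<open>Reversal evaluates the increment of \<open>W\<close> at the right endpoint; \<open>mixed_bound\<close> moves it back to the left.\<close>
  have "enorm d (\<phi> t - \<phi> s - (W t (\<phi> s) - W s (\<phi> s))) \<le> B * (t - s) powr \<theta>"
    if st: "a \<le> s" "s < t" "t \<le> b" for s t
  proof -
    have "enorm d (\<phi> s - \<phi> t - (W s (\<phi> t) - W t (\<phi> t))) \<le> A * (t - s) powr \<theta>"
      using err [of "- t" "- s"] st by (simp add: \<phi>_def)
    then have 1: "enorm d (- (\<phi> s - \<phi> t - (W s (\<phi> t) - W t (\<phi> t)))) \<le> A * (t - s) powr \<theta>"
      by (simp only: enorm_minus)
    have 2: "enorm d ((W t (\<phi> t) - W s (\<phi> t)) - (W t (\<phi> s) - W s (\<phi> s)))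
        \<le> 2 * N * S powr \<beta> * H powr lam * (t - s) powr \<theta>"
    proof (rule mixed_bound)
      show "enorm d (\<phi> t - \<phi> s) \<le> H * (t - s) powr \<tau>" "0 \<le> H"
        using H st by (auto simp: holder_on_def)
    qed (use st S \<phi>Rd in auto)
    have "\<phi> t - \<phi> s - (W t (\<phi> s) - W s (\<phi> s)) = - (\<phi> s - \<phi> t - (W s (\<phi> t) - W t (\<phi> t)))
        + ((W t (\<phi> t) - W s (\<phi> t)) - (W t (\<phi> s) - W s (\<phi> s)))"
      by simp
    from enorm_triangle_le [OF this 1 2] show ?thesis
      by (simp add: B_def distrib_right)
  qed
  moreover have "0 \<le> B"
    using \<psi>(4) N_nonneg by (simp add: B_def)
  moreover have "\<phi> b = v"
    by (simp add: \<phi>_def \<psi>(1))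
  ultimately show thesis
    using that H \<phi>Rd by blast
qed

subsection \<open>Solutions of the integral equation\<close>

lemma restrict:
  assumes "a \<le> c" "e \<le> b"
  shows "young_field d \<beta> \<tau> lam N c e W"
proof (unfold_locales, goal_cases)
  case (10 s t x y)
  then show ?case using assms by (intro mixed) auto
next
  case (11 s t x)
  then show ?case using assms by (intro time) auto
next
  case (12 t x y)
  then show ?case using assms by (intro space) auto
qed (fact tau_pos tau_le lam_pos lam_le young beta_nonneg beta_lam N_nonneg | erule maps)+

lemma holder_on_Un:
  assumes H1: "holder_on {c..e} H1 \<phi>" and H2: "holder_on {e..f} H2 \<phi>"
  shows "holder_on {c..f} (H1 + H2) \<phi>"
  unfolding holder_on_def
proof (intro conjI ballI impI)
  have H0: "0 \<le> H1" "0 \<le> H2"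
    using H1 H2 by (auto simp: holder_on_def)
  then show "0 \<le> H1 + H2" by simp
  fix s t assume st: "s \<in> {c..f}" "t \<in> {c..f}" "s < t"
  have nonneg: "0 \<le> H1 * (t - s) powr \<tau>" "0 \<le> H2 * (t - s) powr \<tau>"
    using H0 by simp_all
  consider "t \<le> e" | "e \<le> s" | "s < e" "e < t" by linarith
  then show "enorm d (\<phi> t - \<phi> s) \<le> (H1 + H2) * (t - s) powr \<tau>"
  proof cases
    case 1
    then show ?thesis
      using holder_on_abs [OF H1, of s t] st nonneg by (simp add: distrib_right)
  next
    case 2
    then show ?thesis
      using holder_on_abs [OF H2, of s t] st nonneg by (simp add: distrib_right)
  next
    case 3
    have "enorm d (\<phi> e - \<phi> s) \<le> H1 * \<bar>e - s\<bar> powr \<tau>"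
      using 3 st by (intro holder_on_abs [OF H1]) auto
    also have "\<dots> \<le> H1 * (t - s) powr \<tau>"
      using 3 H0 tau_pos by (intro mult_left_mono powr_mono2) auto
    finally have 1: "enorm d (\<phi> e - \<phi> s) \<le> H1 * (t - s) powr \<tau>" .
    have "enorm d (\<phi> t - \<phi> e) \<le> H2 * \<bar>t - e\<bar> powr \<tau>"
      using 3 st by (intro holder_on_abs [OF H2]) auto
    also have "\<dots> \<le> H2 * (t - s) powr \<tau>"
      using 3 H0 tau_pos by (intro mult_left_mono powr_mono2) auto
    finally have 2: "enorm d (\<phi> t - \<phi> e) \<le> H2 * (t - s) powr \<tau>" .
    show ?thesis
      using enorm_triangle_le [of "\<phi> t - \<phi> s" "\<phi> e - \<phi> s" "\<phi> t - \<phi> e", OF _ 1 2]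
      by (simp add: distrib_right)
  qed
qed

lemma holder_seminorm_le: "holder_on {s..t} H \<phi> \<Longrightarrow> holder_seminorm d \<tau> s t \<phi> \<le> ennreal H"
  unfolding holder_seminorm_def holder_on_def
  by (intro SUP_least) (auto simp: divide_le_eq intro!: ennreal_leI)

lemma holder_on_if_seminorm_finite:
  assumes "holder_seminorm d \<tau> s t \<phi> < \<infinity>"
  shows "holder_on {s..t} (enn2real (holder_seminorm d \<tau> s t \<phi>)) \<phi>"
  unfolding holder_on_def
proof (intro conjI ballI impI)
  fix x y assume "x \<in> {s..t}" "y \<in> {s..t}" "x < y"
  then have "ennreal (enorm d (\<phi> y - \<phi> x) / \<bar>y - x\<bar> powr \<tau>) \<le> holder_seminorm d \<tau> s t \<phi>"
    unfolding holder_seminorm_def by (intro SUP_upper2 [of "(x, y)"]) auto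
  also have "\<dots> = ennreal (enn2real (holder_seminorm d \<tau> s t \<phi>))"
    using assms by (simp add: less_top)
  finally show "enorm d (\<phi> y - \<phi> x) \<le> enn2real (holder_seminorm d \<tau> s t \<phi>) * (y - x) powr \<tau>"
    using \<open>x < y\<close> by (simp add: divide_le_eq)
qed simp

lemma solution_exists:
  assumes T: "0 < T" and ab: "a = t0 - T" "b = t0 + T" and v: "v \<in> Rd d"
  shows "\<exists>\<phi>\<in>holder_space d \<tau> a b. is_solution d W t0 T v \<phi>"
proof -
  interpret left: young_field d \<beta> \<tau> lam N a t0 W
    using T ab by (intro restrict) auto
  interpret right: young_field d \<beta> \<tau> lam N t0 b W
    using T ab by (intro restrict) auto
  obtain \<phi>1 H1 A1 where 1: "\<phi>1 t0 = v" "\<And>t. t \<in> {a..t0} \<Longrightarrow> \<phi>1 t \<in> Rd d" "holder_on {a..t0} H1 \<phi>1" "0 \<le> A1"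
    and err1: "\<And>s t. a \<le> s \<Longrightarrow> s < t \<Longrightarrow> t \<le> t0 \<Longrightarrow>
      enorm d (\<phi>1 t - \<phi>1 s - (W t (\<phi>1 s) - W s (\<phi>1 s))) \<le> A1 * (t - s) powr \<theta>"
    using left.backward_solution [of v] T ab v by (metis diff_less_eq less_add_same_cancel1)
  obtain \<phi>2 H2 A2 where 2: "\<phi>2 t0 = v" "\<And>t. t \<in> {t0..b} \<Longrightarrow> \<phi>2 t \<in> Rd d" "holder_on {t0..b} H2 \<phi>2" "0 \<le> A2"
    and err2: "\<And>s t. t0 \<le> s \<Longrightarrow> s < t \<Longrightarrow> t \<le> b \<Longrightarrow>
      enorm d (\<phi>2 t - \<phi>2 s - (W t (\<phi>2 s) - W s (\<phi>2 s))) \<le> A2 * (t - s) powr \<theta>"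
    using right.forward_solution [of v] T ab v by (metis less_add_same_cancel1)
  \<comment> \<open>The halves agree at \<open>t0\<close>. Since the equation is based there, no
    integral across \<open>t0\<close> is needed.\<close>
  define \<phi> where "\<phi> t = (if t \<le> t0 then \<phi>1 t else \<phi>2 t)" for t
  have \<phi>1: "\<phi> t = \<phi>1 t" if "t \<le> t0" for t
    using that by (simp add: \<phi>_def)
  have \<phi>2: "\<phi> t = \<phi>2 t" if "t0 \<le> t" for t
    using that 1(1) 2(1) by (auto simp: \<phi>_def)
  have \<phi>Rd: "\<phi> t \<in> Rd d" if "t \<in> {a..b}" for t
    using that 1(2) 2(2) by (auto simp: \<phi>_def)
  have "holder_on {a..t0} H1 \<phi>" "holder_on {t0..b} H2 \<phi>"
    using 1(3) 2(3) by (auto simp: holder_on_def \<phi>1 \<phi>2)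
  then have "holder_on {a..b} (H1 + H2) \<phi>"
    by (rule holder_on_Un)
  then have "holder_seminorm d \<tau> a b \<phi> < \<infinity>"
    using holder_seminorm_le ennreal_less_top order_le_less_trans by (metis infinity_ennreal_def)
  then have "\<phi> \<in> holder_space d \<tau> a b"
    using \<phi>Rd by (simp add: holder_space_def)
  moreover have "is_solution d W t0 T v \<phi>"
    unfolding is_solution_def
  proof
    fix t assume t: "t \<in> {t0 - T..t0 + T}"
    have t0: "\<phi> t0 = v"
      using \<phi>1 1(1) by simp
    have diff: "\<phi> y - \<phi> x \<in> Rd d" if "x \<in> {a..b}" "y \<in> {a..b}" for x y
      using that by (intro Rd_diff \<phi>Rd)
    show "\<exists>I. has_oriented_young_integral d W \<phi> t0 t I \<and> \<phi> t = v + I"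
    proof (cases "t0 \<le> t")
      case True
      have "has_young_integral d W \<phi> t0 t (\<phi> t - \<phi> t0)"
      proof (rule has_young_integralI [OF young 2(4) True])
        show "\<phi> t - \<phi> t0 \<in> Rd d"
          using t T ab by (intro diff) auto
        fix x y assume "t0 \<le> x" "x < y" "y \<le> t"
        then show "enorm d (\<phi> y - \<phi> x - (W y (\<phi> x) - W x (\<phi> x))) \<le> A2 * (y - x) powr \<theta>"
          using err2 [of x y] t ab by (simp add: \<phi>2)
      qed
      then show ?thesis
        using True by (intro exI [of _ "\<phi> t - \<phi> t0"]) (simp add: has_oriented_young_integral_def t0)
    next
      case False
      have "has_young_integral d W \<phi> t t0 (\<phi> t0 - \<phi> t)"
      proof (rule has_young_integralI [OF young 1(4)])
        show "t \<le> t0"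
          using False by simp
        show "\<phi> t0 - \<phi> t \<in> Rd d"
          using t T ab by (intro diff) auto
        fix x y assume "t \<le> x" "x < y" "y \<le> t0"
        then show "enorm d (\<phi> y - \<phi> x - (W y (\<phi> x) - W x (\<phi> x))) \<le> A1 * (y - x) powr \<theta>"
          using err1 [of x y] t ab by (simp add: \<phi>1)
      qed
      moreover have "\<phi> t - \<phi> t0 = (\<lambda>k. - (\<phi> t0 - \<phi> t) k)"
        by (simp add: fun_eq_iff)
      ultimately show ?thesis
        using False by (intro exI [of _ "\<phi> t - \<phi> t0"]) (auto simp: has_oriented_young_integral_def t0)
    qed
  qed
  ultimately show ?thesis by blast
qed

end

section \<open>The a priori bound for solutions\<close>

text \<open>The partition with \<open>m = 0\<close> is admissible for every mesh and has empty sum.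
  This yields the initial condition at \<open>t0\<close>.\<close>

lemma has_young_integral_trivial:
  assumes "has_young_integral d W \<phi> s s I"
  shows "I = 0"
proof -
  have "enorm d I < \<epsilon>" if "0 < \<epsilon>" for \<epsilon>
  proof -
    obtain \<delta> where "\<And>m p. is_partition s s m p \<and> (\<forall>i<m. p (Suc i) - p i < \<delta>) \<Longrightarrow>
        enorm d (young_sum W \<phi> m p - I) < \<epsilon>"
      using assms \<open>0 < \<epsilon>\<close> unfolding has_young_integral_def by blast
    from this [of 0 "\<lambda>_. s"] have "enorm d (0 - I) < \<epsilon>"
      by (simp only: young_sum_def) (simp add: is_partition_def)
    then show ?thesis
      by (simp only: diff_0 enorm_minus)
  qed
  then have "enorm d I = 0"
    using enorm_nonneg [of d I] by (metis less_irrefl less_eq_real_def)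
  then show ?thesis
    using assms by (simp add: enorm_eq_0_iff has_young_integral_def)
qed

text \<open>Rebases the equation from \<open>t0\<close> to subintervals, on each side separately;
  the sides are rejoined only at the level of bounds.\<close>

lemma is_solution_increment:
  assumes sol: "is_solution d W t0 T v \<phi>" and T: "0 < T"
  shows "\<phi> t0 = v"
    and "\<And>s t. t0 \<le> s \<Longrightarrow> s < t \<Longrightarrow> t \<le> t0 + T \<Longrightarrow> has_young_integral d W \<phi> s t (\<phi> t - \<phi> s)"
    and "\<And>s t. t0 - T \<le> s \<Longrightarrow> s < t \<Longrightarrow> t \<le> t0 \<Longrightarrow> has_young_integral d W \<phi> s t (\<phi> t - \<phi> s)"
proof -
  have right: "has_young_integral d W \<phi> t0 t (\<phi> t - v)" if "t0 \<le> t" "t \<le> t0 + T" for t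
  proof -
    have "t \<in> {t0 - T..t0 + T}"
      using that T by simp
    then obtain I where "has_oriented_young_integral d W \<phi> t0 t I" "\<phi> t = v + I"
      using sol unfolding is_solution_def by blast
    then show ?thesis
      using that by (simp add: has_oriented_young_integral_def)
  qed
  then have "\<phi> t0 - v = 0"
    using T by (intro has_young_integral_trivial [of d W \<phi> t0]) simp
  then show \<phi>0: "\<phi> t0 = v"
    by simp
  have left: "has_young_integral d W \<phi> t t0 (v - \<phi> t)" if t: "t0 - T \<le> t" "t \<le> t0" for t
  proof (cases "t = t0")
    case True
    then show ?thesis
      using right [of t0] T \<phi>0 by simp
  next
    case False
    have "t \<in> {t0 - T..t0 + T}"
      using that T by simp
    then obtain I where "has_oriented_young_integral d W \<phi> t0 t I" "\<phi> t = v + I"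
      using sol unfolding is_solution_def by blast
    then obtain J where J: "has_young_integral d W \<phi> t t0 J" "\<phi> t = v + (\<lambda>k. - J k)"
      using t False by (auto simp: has_oriented_young_integral_def)
    then have "v - \<phi> t = J"
      by (simp add: fun_eq_iff)
    with J show ?thesis by simp
  qed
  show "has_young_integral d W \<phi> s t (\<phi> t - \<phi> s)" if "t0 \<le> s" "s < t" "t \<le> t0 + T" for s t
    using has_young_integral_diff_left [OF that(1) right [of s] right [of t]] that by simp
  show "has_young_integral d W \<phi> s t (\<phi> t - \<phi> s)" if "t0 - T \<le> s" "s < t" "t \<le> t0" for s t
    using has_young_integral_diff_right [OF that(3) left [of t] left [of s]] that by simp
qed

context young_field
begin

lemma solution_bound:
  assumes T: "0 < T" and ab: "a = t0 - T" "b = t0 + T"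
    and \<phi>: "\<phi> \<in> holder_space d \<tau> a b" and sol: "is_solution d W t0 T v \<phi>"
  obtains M :: nat where "0 < M" "real M \<le> 2 + T * (2 * (1 + K)) powr (1 / \<tau>) * N powr (1 / \<tau>)"
    "\<And>t. t \<in> {a..b} \<Longrightarrow> enorm d (\<phi> t) \<le> 2 ^ M * (1 + enorm d v)"
    "holder_on {a..b} (4 * (2 ^ M * (1 + enorm d v)) / (T / M) powr \<tau>) \<phi>"
proof -
  obtain M :: nat where M: "0 < M" "N * (T / M) powr \<tau> * (1 + K) \<le> 1 / 2"
    and M_le: "real M \<le> 2 + T * (2 * (1 + K)) powr (1 / \<tau>) * N powr (1 / \<tau>)"
    using step_exists [OF T] by blast
  define S where "S = 2 ^ M * (1 + enorm d v)"
  define \<Delta> where "\<Delta> = T / M"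
  have \<Delta>: "0 < \<Delta>"
    using T M by (simp add: \<Delta>_def)
  obtain H0 where H0: "holder_on {a..b} H0 \<phi>"
    using \<phi> holder_on_if_seminorm_finite by (auto simp: holder_space_def)
  have \<phi>Rd: "\<phi> t \<in> Rd d" if "t \<in> {a..b}" for t
    using \<phi> that by (simp add: holder_space_def)
  note inc = is_solution_increment [OF sol T]
  \<comment> \<open>Used with \<open>t0\<close> as the right end and as the left end. Both halves
    have length \<open>T\<close>, so one \<open>M\<close> serves both.\<close>
  have side: "(\<forall>t\<in>{c..e}. 1 + enorm d (\<phi> t) \<le> S) \<and> holder_on {c..e} (2 * S / \<Delta> powr \<tau>) \<phi>"
    if ce: "a \<le> c" "c \<le> t0" "t0 \<le> e" "e \<le> b"
      and int: "\<And>s t. c \<le> s \<Longrightarrow> s < t \<Longrightarrow> t \<le> e \<Longrightarrow> has_young_integral d W \<phi> s t (\<phi> t - \<phi> s)" for c e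
  proof -
    have sub: "{c..e} \<subseteq> {a..b}"
      using ce by auto
    have davie: "davie_on {c..e} \<phi>"
      using ce \<phi>Rd by (intro davie_on_if_integral int) auto
    have chain: "\<exists>x. x 0 = t0 \<and> x M = t \<and> (\<forall>k\<le>M. x k \<in> {c..e}) \<and> (\<forall>k<M. \<bar>x (Suc k) - x k\<bar> \<le> \<Delta>)"
      if t: "t \<in> {c..e}" for t
    proof -
      \<comment> \<open>Equidistant points from \<open>t0\<close> to \<open>t\<close> in either
        direction.\<close>
      define x where "x k = t0 + real k / real M * (t - t0)" for k
      have "x k \<in> {c..e}" if "k \<le> M" for k
      proof -
        have u: "0 \<le> real k / real M" "real k / real M \<le> 1"
          using that M by simp_all
        have "x k = (1 - real k / real M) * t0 + real k / real M * t"
          by (simp add: x_def algebra_simps diff_divide_distrib)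
        then show ?thesis
          using convexD_alt [OF convex_real_interval(5), of t0 c e t "real k / real M"] ce t u by simp
      qed
      moreover have "\<bar>x (Suc k) - x k\<bar> \<le> \<Delta>" for k
      proof -
        have "x (Suc k) - x k = (t - t0) / real M"
          by (simp add: x_def add_divide_distrib distrib_right)
        moreover have "\<bar>t - t0\<bar> \<le> T"
          using t ce ab by auto
        ultimately show ?thesis
          using M by (simp add: \<Delta>_def divide_right_mono)
      qed
      moreover have "x 0 = t0" "x M = t"
        using M by (simp_all add: x_def)
      ultimately show ?thesis by blast
    qed
    have "holder_on {c..e} H0 \<phi>"
      using holder_on_subset [OF H0 sub] .
    from global_bound [OF sub _ davie this \<Delta> M(2) [folded \<Delta>_def] chain] show ?thesis
      using sub \<phi>Rd inc(1) unfolding S_def by blast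
  qed
  have left: "(\<forall>t\<in>{a..t0}. 1 + enorm d (\<phi> t) \<le> S) \<and> holder_on {a..t0} (2 * S / \<Delta> powr \<tau>) \<phi>"
    using T ab by (intro side inc(3)) auto
  have right: "(\<forall>t\<in>{t0..b}. 1 + enorm d (\<phi> t) \<le> S) \<and> holder_on {t0..b} (2 * S / \<Delta> powr \<tau>) \<phi>"
    using T ab by (intro side inc(2)) auto
  have "enorm d (\<phi> t) \<le> S" if "t \<in> {a..b}" for t
  proof -
    have "t \<in> {a..t0} \<or> t \<in> {t0..b}"
      using that by auto
    then show ?thesis
      using left right by fastforce
  qed
  \<comment> \<open>Gluing at \<open>t0\<close> adds the two constants.\<close>
  moreover have "holder_on {a..b} (4 * S / \<Delta> powr \<tau>) \<phi>"
    using holder_on_Un [of a t0 "2 * S / \<Delta> powr \<tau>" \<phi> b "2 * S / \<Delta> powr \<tau>"] left right by simp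
  ultimately show thesis
    using that [OF M(1) M_le] by (simp add: S_def \<Delta>_def)
qed

end

section \<open>From \<open>W_norm\<close> to the standing bounds, and the final constants\<close>

text \<open>Each supremum is at most the whole sum. The suprema leave out \<open>x = y\<close> and
  \<open>s \<ge> t\<close>: on the diagonal both sides vanish, and reversed order follows by
  symmetry.\<close>

lemma young_field_W_norm:
  assumes "0 < \<tau>" "\<tau> \<le> 1" "0 < lam" "lam \<le> 1" "1 < \<tau> * (1 + lam)" "0 \<le> \<beta>" "\<beta> + lam \<le> 1"
    and maps: "\<forall>t. \<forall>x\<in>Rd d. W t x \<in> Rd d" and fin: "W_norm d \<beta> \<tau> lam a b W < \<infinity>"
  shows "young_field d \<beta> \<tau> lam (enn2real (W_norm d \<beta> \<tau> lam a b W)) a b W"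
proof
  define N where "N = enn2real (W_norm d \<beta> \<tau> lam a b W)"
  have N: "q \<le> N" if "ennreal q \<le> W_norm d \<beta> \<tau> lam a b W" for q
  proof -
    \<comment> \<open>Finiteness is essential, since \<open>enn2real\<close> sends infinity to
      0.\<close>
    have eq: "W_norm d \<beta> \<tau> lam a b W = ennreal N"
      using fin by (simp add: N_def less_top)
    have "ennreal q \<le> ennreal N"
      using that by (simp only: eq)
    then show ?thesis
      by (subst (asm) ennreal_le_iff) (simp_all add: N_def)
  qed
  have pos: "0 < enorm d (x - y)" if "x \<in> Rd d" "y \<in> Rd d" "x \<noteq> y" for x y
    using that Rd_diff [OF that(1,2)] enorm_eq_0_iff [of "x - y" d] by (auto simp: less_le)
  have pos1: "0 < 1 + enorm d x" "0 < 1 + enorm d x + enorm d y" for x y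
    using enorm_nonneg [of d x] enorm_nonneg [of d y] by linarith+
  have mixed: "enorm d ((W t x - W s x) - (W t y - W s y))
      \<le> N * (1 + enorm d x + enorm d y) powr \<beta> * \<bar>t - s\<bar> powr \<tau> * enorm d (x - y) powr lam"
    if "s \<in> {a..b}" "t \<in> {a..b}" "x \<in> Rd d" "y \<in> Rd d" "s < t" "x \<noteq> y" for s t x y
  proof -
    have "ennreal (enorm d (W s x - W t x - W s y + W t y) /
          ((1 + enorm d x + enorm d y) powr \<beta> * \<bar>t - s\<bar> powr \<tau> * enorm d (x - y) powr lam))
        \<le> W_norm d \<beta> \<tau> lam a b W"
      unfolding W_norm_def using that
      by (intro add_increasing2 [OF zero_le] SUP_upper2 [of "(s, t, x, y)"]) auto
    from N [OF this]
    have "enorm d (W s x - W t x - W s y + W t y)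
        \<le> N * ((1 + enorm d x + enorm d y) powr \<beta> * \<bar>t - s\<bar> powr \<tau> * enorm d (x - y) powr lam)"
      using that pos [of x y] pos1(2) [of x y] by (simp add: divide_le_eq)
    moreover have "W s x - W t x - W s y + W t y = - ((W t x - W s x) - (W t y - W s y))"
      by simp
    then have "enorm d (W s x - W t x - W s y + W t y) = enorm d ((W t x - W s x) - (W t y - W s y))"
      by (simp only: enorm_minus)
    ultimately show ?thesis
      by (simp only: mult.assoc)
  qed
  have time: "enorm d (W t x - W s x) \<le> N * (1 + enorm d x) powr (\<beta> + lam) * \<bar>t - s\<bar> powr \<tau>"
    if "s \<in> {a..b}" "t \<in> {a..b}" "x \<in> Rd d" "s < t" for s t x
  proof -
    have "ennreal (enorm d (W s x - W t x) / ((1 + enorm d x) powr (\<beta> + lam) * \<bar>t - s\<bar> powr \<tau>))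
        \<le> W_norm d \<beta> \<tau> lam a b W"
      unfolding W_norm_def using that
      by (intro add_increasing2 [OF zero_le] add_increasing [OF zero_le] SUP_upper2 [of "(s, t, x)"]) auto
    from N [OF this] show ?thesis
      using that pos1(1) [of x] by (simp add: divide_le_eq enorm_minus_commute [of d "W s x"] mult.assoc)
  qed
  show "enorm d (W t x - W s x) \<le> N * (1 + enorm d x) powr (\<beta> + lam) * \<bar>t - s\<bar> powr \<tau>"
    if "s \<in> {a..b}" "t \<in> {a..b}" "x \<in> Rd d" for s t x
  proof (cases s t rule: linorder_cases)
    case less
    then show ?thesis using time that by simp
  next
    case greater
    then show ?thesis using time [of t s x] that
      by (simp only: enorm_minus_commute [of d "W t x"] abs_minus_commute [of t])
  qed simp
  show "enorm d ((W t x - W s x) - (W t y - W s y))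
      \<le> N * (1 + enorm d x + enorm d y) powr \<beta> * \<bar>t - s\<bar> powr \<tau> * enorm d (x - y) powr lam"
    if "s \<in> {a..b}" "t \<in> {a..b}" "x \<in> Rd d" "y \<in> Rd d" for s t x y
  proof (cases "x = y \<or> s = t")
    case False
    have eq: "(W t x - W s x) - (W t y - W s y) = - ((W s x - W t x) - (W s y - W t y))"
      by simp
    show ?thesis
    proof (cases "s < t")
      case True
      then show ?thesis using mixed that False by blast
    next
      case ge: False
      then have "enorm d ((W s x - W t x) - (W s y - W t y))
          \<le> N * (1 + enorm d x + enorm d y) powr \<beta> * \<bar>s - t\<bar> powr \<tau> * enorm d (x - y) powr lam"
        using mixed [of t s x y] that False by linarith
      then show ?thesis
        by (simp only: eq enorm_minus abs_minus_commute [of t])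
    qed
  qed auto
  show "enorm d (W t x - W t y) \<le> N * (1 + enorm d x + enorm d y) powr \<beta> * enorm d (x - y) powr lam"
    if "t \<in> {a..b}" "x \<in> Rd d" "y \<in> Rd d" for t x y
  proof (cases "x = y")
    case False
    have "ennreal (enorm d (W t y - W t x) / ((1 + enorm d x + enorm d y) powr \<beta> * enorm d (x - y) powr lam))
        \<le> W_norm d \<beta> \<tau> lam a b W"
      unfolding W_norm_def using that False
      by (intro add_increasing [OF zero_le] SUP_upper2 [of "(t, x, y)"]) auto
    from N [OF this] show ?thesis
      using that pos [of x y] False pos1(2) [of x y]
      by (simp add: divide_le_eq enorm_minus_commute [of d "W t y"] mult.assoc)
  qed simp
  show "0 \<le> N" by (simp add: N_def)
qed (use assms in auto)

text \<open>The covering argument gives \<open>N powr (1 / \<tau>)\<close>, which is better than the exponent of the theorem.\<close>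

lemma powr_inverse_le:
  fixes N \<tau> lam :: real
  assumes "0 < \<tau>" "\<tau> \<le> 1" "0 < lam" "lam \<le> 1" "0 \<le> N"
  shows "N powr (1 / \<tau>) \<le> 1 + N powr ((1 - \<tau> + \<tau> * lam) / (\<tau> * lam))"
proof (cases "N \<le> 1")
  case True
  then have "N powr (1 / \<tau>) \<le> 1 powr (1 / \<tau>)"
    using assms by (intro powr_mono2) auto
  then show ?thesis
    by (simp add: add_increasing2)
next
  case False
  \<comment> \<open>This is the comparison of the two exponents with denominators cleared.\<close>
  have "0 \<le> (1 - \<tau>) * (1 - lam)"
    using assms by simp
  then have "1 / \<tau> \<le> (1 - \<tau> + \<tau> * lam) / (\<tau> * lam)"
    using assms by (simp add: field_simps)
  then have "N powr (1 / \<tau>) \<le> N powr ((1 - \<tau> + \<tau> * lam) / (\<tau> * lam))"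
    using False by (intro powr_mono) auto
  then show ?thesis
    by linarith
qed

text \<open>The Hoelder part carries a factor \<open>M powr \<tau>\<close>, which is at most
  \<open>2 ^ M\<close>, so both parts are of order \<open>4 ^ M\<close>; the linear bound on
  \<open>M\<close> then moves into the exponent.\<close>

lemma constant_bound:
  fixes M :: nat and T \<tau> c X V :: real
  assumes T: "0 < T" and tau: "0 < \<tau>" "\<tau> \<le> 1" and M: "0 < M" "real M \<le> 2 + c * (1 + X)" and V: "0 \<le> V"
  shows "2 ^ M * (1 + V) + 4 * (2 ^ M * (1 + V)) / (T / M) powr \<tau>
    \<le> 2 * (1 + 4 / T powr \<tau>) * exp ((2 + c) * ln 4) * exp (c * ln 4 * X) * max 1 V"
proof -
  have "real M powr \<tau> \<le> real M powr 1"
    using M tau by (intro powr_mono) auto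
  also have "\<dots> \<le> 2 ^ M"
    using M less_imp_le [OF of_nat_less_two_power, of M] by simp
  finally have M2: "real M powr \<tau> \<le> 2 ^ M" .
  have "2 ^ M * (1 + V) + 4 * (2 ^ M * (1 + V)) / (T / M) powr \<tau>
      = 2 ^ M * (1 + V) * (1 + 4 / T powr \<tau> * real M powr \<tau>)"
    using T M by (simp add: powr_divide field_simps)
  also have "\<dots> \<le> 2 ^ M * (2 * max 1 V) * (2 ^ M + 4 / T powr \<tau> * 2 ^ M)"
    using V M2 by (intro mult_mono add_mono mult_left_mono) auto
  also have "\<dots> = 2 * (1 + 4 / T powr \<tau>) * 4 ^ M * max 1 V"
    by (simp add: algebra_simps flip: power_mult_distrib)
  also have "4 ^ M \<le> exp ((2 + c) * ln 4) * exp (c * ln 4 * X)"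
  proof -
    have "(4::real) ^ M = exp (real M * ln 4)"
      by (simp add: exp_of_nat_mult)
    also have "\<dots> \<le> exp ((2 + c * (1 + X)) * ln 4)"
      using M by (simp add: mult_right_mono)
    also have "\<dots> = exp ((2 + c) * ln 4) * exp (c * ln 4 * X)"
      by (simp add: algebra_simps flip: exp_add)
    finally show ?thesis .
  qed
  finally show ?thesis
    by (simp add: mult_left_mono mult_right_mono mult.assoc)
qed

theorem theorem3p1:
  fixes \<tau> lam T :: real
  assumes "0 < \<tau>" "\<tau> \<le> 1" "0 < lam" "lam \<le> 1"
    and "\<tau> * (1 + lam) > 1"
    and "T > 0"
  shows "\<exists>C \<kappa> :: real. C > 0 \<and> \<kappa> > 0 \<and>
    (\<forall>(d::nat) (\<beta>::real) (W :: real \<Rightarrow> vec_seq \<Rightarrow> vec_seq) (t0::real) (v::vec_seq).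
       d \<ge> 1 \<and> \<beta> \<ge> 0 \<and> \<beta> + lam \<le> 1 \<and>
       (\<forall>t. \<forall>x\<in>Rd d. W t x \<in> Rd d) \<and>
       (\<forall>a b. a < b \<longrightarrow> W_norm d \<beta> \<tau> lam a b W < \<infinity>) \<and>
       v \<in> Rd d \<longrightarrow>
       (\<exists>\<phi> \<in> holder_space d \<tau> (t0 - T) (t0 + T). is_solution d W t0 T v \<phi>) \<and>
       (\<forall>\<phi> \<in> holder_space d \<tau> (t0 - T) (t0 + T). is_solution d W t0 T v \<phi> \<longrightarrow>
          sup_norm d (t0 - T) (t0 + T) \<phi> + holder_seminorm d \<tau> (t0 - T) (t0 + T) \<phi>
          \<le> ennreal (C *
               exp (\<kappa> * enn2real (W_norm d \<beta> \<tau> lam (t0 - T) (t0 + T) W)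
                        powr ((1 - \<tau> + \<tau> * lam) / (\<tau> * lam))) *
               max 1 (enorm d v))))"
proof -
  \<comment> \<open>The coefficient in the bound on the number of steps, with \<open>K\<close>
    written out, so that it is fixed before \<open>d\<close>, \<beta> and \<open>W\<close>;
    \<open>c * ln 4\<close> becomes the constant in the exponent.\<close>
  define c where "c = T * (2 * (1 + 2 * sewing_const (\<tau> * (1 + lam)))) powr (1 / \<tau>)"
  define C where "C = 2 * (1 + 4 / T powr \<tau>) * exp ((2 + c) * ln 4)"
  have c: "0 < c"
    using sewing_const_pos [OF assms(5)] \<open>T > 0\<close> by (simp add: c_def)
  show ?thesis
  proof (intro exI conjI allI impI)
    show "0 < C"
      using \<open>T > 0\<close> by (simp add: C_def add_pos_nonneg)
    show "0 < c * ln 4"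
      using c by simp
    fix d :: nat and \<beta> t0 :: real and W :: "real \<Rightarrow> vec_seq \<Rightarrow> vec_seq" and v :: vec_seq
    assume hyp: "d \<ge> 1 \<and> \<beta> \<ge> 0 \<and> \<beta> + lam \<le> 1 \<and> (\<forall>t. \<forall>x\<in>Rd d. W t x \<in> Rd d) \<and>
       (\<forall>a b. a < b \<longrightarrow> W_norm d \<beta> \<tau> lam a b W < \<infinity>) \<and> v \<in> Rd d"
    define N where "N = enn2real (W_norm d \<beta> \<tau> lam (t0 - T) (t0 + T) W)"
    define X where "X = N powr ((1 - \<tau> + \<tau> * lam) / (\<tau> * lam))"
    interpret young_field d \<beta> \<tau> lam N "t0 - T" "t0 + T" W
      unfolding N_def using assms hyp by (intro young_field_W_norm) auto
    show "\<exists>\<phi> \<in> holder_space d \<tau> (t0 - T) (t0 + T). is_solution d W t0 T v \<phi>"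
      using hyp \<open>T > 0\<close> by (intro solution_exists) auto
    show "\<forall>\<phi> \<in> holder_space d \<tau> (t0 - T) (t0 + T). is_solution d W t0 T v \<phi> \<longrightarrow>
          sup_norm d (t0 - T) (t0 + T) \<phi> + holder_seminorm d \<tau> (t0 - T) (t0 + T) \<phi>
          \<le> ennreal (C * exp (c * ln 4 * enn2real (W_norm d \<beta> \<tau> lam (t0 - T) (t0 + T) W)
                        powr ((1 - \<tau> + \<tau> * lam) / (\<tau> * lam))) * max 1 (enorm d v))"
    proof (intro ballI impI)
      fix \<phi> assume \<phi>: "\<phi> \<in> holder_space d \<tau> (t0 - T) (t0 + T)" "is_solution d W t0 T v \<phi>"
      obtain M :: nat where M: "0 < M" "real M \<le> 2 + T * (2 * (1 + K)) powr (1 / \<tau>) * N powr (1 / \<tau>)"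
        and S: "\<And>t. t \<in> {t0 - T..t0 + T} \<Longrightarrow> enorm d (\<phi> t) \<le> 2 ^ M * (1 + enorm d v)"
        and H: "holder_on {t0 - T..t0 + T} (4 * (2 ^ M * (1 + enorm d v)) / (T / M) powr \<tau>) \<phi>"
        using solution_bound [OF \<open>T > 0\<close> refl refl \<phi>] by blast
      have "real M \<le> 2 + c * N powr (1 / \<tau>)"
        using M(2) by (simp add: c_def K_def)
      also have "\<dots> \<le> 2 + c * (1 + X)"
        using c powr_inverse_le [of \<tau> lam N] assms N_nonneg by (simp add: X_def)
      finally have M_le: "real M \<le> 2 + c * (1 + X)" .
      have "sup_norm d (t0 - T) (t0 + T) \<phi> \<le> ennreal (2 ^ M * (1 + enorm d v))"
        unfolding sup_norm_def using S by (intro SUP_least ennreal_leI)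
      then have "sup_norm d (t0 - T) (t0 + T) \<phi> + holder_seminorm d \<tau> (t0 - T) (t0 + T) \<phi>
          \<le> ennreal (2 ^ M * (1 + enorm d v)) + ennreal (4 * (2 ^ M * (1 + enorm d v)) / (T / M) powr \<tau>)"
        using holder_seminorm_le [OF H] by (rule add_mono)
      also have "\<dots> = ennreal (2 ^ M * (1 + enorm d v) + 4 * (2 ^ M * (1 + enorm d v)) / (T / M) powr \<tau>)"
        by (rule ennreal_plus [symmetric]) (simp_all add: add_nonneg_nonneg)
      also have "\<dots> \<le> ennreal (C * exp (c * ln 4 * X) * max 1 (enorm d v))"
        unfolding C_def using assms M(1) M_le by (intro ennreal_leI constant_bound) auto
      finally show "sup_norm d (t0 - T) (t0 + T) \<phi> + holder_seminorm d \<tau> (t0 - T) (t0 + T) \<phi>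
          \<le> ennreal (C * exp (c * ln 4 * enn2real (W_norm d \<beta> \<tau> lam (t0 - T) (t0 + T) W)
                        powr ((1 - \<tau> + \<tau> * lam) / (\<tau> * lam))) * max 1 (enorm d v))"
        by (simp only: X_def N_def)
    qed
  qed
qed

end
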